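(* Suppose (A0), (A1'), (A2') and (A3') (stated in the context) hold. Given $q:\mathbb R^p\to\mathbb R$, let $b(\theta)=q(\theta)\pi(\theta)$ and assume $b$ satisfies (ALap) (stated in the context). For any positive sequence $\alpha_n$ with $\alpha_nn\to\infty$, the following hold for $n$ sufficiently large. 1. With $H_n$ the matrix from (A2'), $$\int_{\mathbb R^p}b(\theta)e^{\alpha_n\log f_n(X^n|\theta)}d\theta=e^{\alpha_n\log f_n(X^n|\hat\theta)}\,|H_n|^{-1/2}\Big(\frac{2\pi}{\alpha_nn}\Big)^{p/2}\Big(b(\hat\theta)+O_{f_{0,n}}\Big(\frac1{\alpha_nn}\Big)\Big).$$ 2. $$\int_{\mathbb R^p}q(\theta)\,\pi_{n,\alpha_n}(\theta|X^n)\,d\theta=q(\hat\theta)+O_{f_{0,n}}\Big(\frac1{\alpha_nn}\Big).$$ Furthermore, suppose that for a data-dependent, positive sequence $\hat\alpha_n$ there exists a positive sequence $\alpha_n$ with $\alpha_nn\to\infty$ such that $\hat\alpha_n/\alpha_n\to1$ in $f_{0,n}$-probability. Then item 2 holds with $\pi_{n,\alpha_n}(\theta|X^n)$ replaced by $\pi_{n,\hat\alpha_n}(\theta|X^n)$.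
   Context: Setting. For each $n$, $X^n=(X_1,\dots,X_n)\in\mathcal X^n$ ($\mathcal X\subset\mathbb R^d$) is a random sample with true density $f_{0,n}$; $\mathbb P_{f_{0,n}}$ is the corresponding probability. $\{f_n(\cdot|\theta):\theta\in\Theta\subset\mathbb R^p\}$ is a parametric family of densities, possibly misspecified. $\hat\theta=\arg\max_\theta f_n(X^n|\theta)$ is the MLE and $\pi(\theta)$ is a prior density (in $2\pi$ the symbol is the number). For $\alpha>0$ the $\alpha$-posterior has density $\pi_{n,\alpha}(\theta|X^n)=f_n(X^n|\theta)^\alpha\pi(\theta)/\int_{\mathbb R^p}f_n(X^n|\theta)^\alpha\pi(\theta)\,d\theta$; the $\hat\alpha_n$-posterior is obtained by plugging in a data-dependent $\hat\alpha_n$. All these posteriors are assumed proper. Integrands in $\theta$ are understood as zero outside $\Theta$. $|H|$ is the determinant of $H$. $Y_n=O_{f_{0,n}}(1)$ means: for every $\epsilon>0$ there is $M>0$ with $\mathbb P_{f_{0,n}}(\|Y_n\|_2>M)<\epsilon$ for all sufficiently large $n$; $Y_n=O_{f_{0,n}}(a_n)$ means $Y_n/a_n=O_{f_{0,n}}(1)$. $B_v(r)$ is the open Euclidean ball. For a tensor $S\in\mathbb R^{p\times p\times p}$, $\langle S,h^{\otimes3}\rangle=\sum_{i,j,k}S_{ijk}h_ih_jh_k$. Assumptions; $\alpha_n$ in (A2') and (ALap) is the sequence under consideration. (A0) The MLE $\hat\theta$ is unique and there exists $\theta^*\in\Theta$, with $\Theta$ an open subset of $\mathbb R^p$, such that $\hat\theta\to\theta^*$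 in $f_{0,n}$-probability and $\sqrt n(\hat\theta-\theta^* )$ is asymptotically normal. (A1') The prior $\pi$ is positive and twice continuously differentiable in an open ball around $\theta^*$, and the prior mean is finite. (A2') For $n$ sufficiently large there exist a (data-dependent) matrix $H_n\in\mathbb R^{p\times p}$ that is symmetric and positive definite with probability tending to one, a tensor $S_n\in\mathbb R^{p\times p\times p}$, and a constant $M<\infty$ such that for all $\epsilon>0$ and some $\delta>0$, $$\mathbb P_{f_{0,n}}\Big(\sup_{h\in\mathcal H_n}\Big\{|\tilde R_n(h)|-\frac{M}{\alpha_nn}\|h\|_2^4\Big\}>0\Big)<\epsilon,$$ where $\mathcal H_n=\{h\in\mathbb R^p:\|h\|_2/\sqrt{\alpha_nn}\le\delta\}$ and $$\tilde R_n(h)=\alpha_n\Big[\log f_n\Big(X^n\Big|\hat\theta+\tfrac{h}{\sqrt{\alpha_nn}}\Big)-\log f_n(X^n|\hat\theta)\Big]+\tfrac12h^\top H_nh-\tfrac{1}{6\sqrt{\alpha_nn}}\langle S_n,h^{\otimes3}\rangle.$$ (A3') For all $\epsilon>0$ and $\delta'>0$ there exists $c=c(\epsilon,\delta')>0$ such that for $n$ sufficiently large $$\mathbb P_{f_{0,n}}\Big(\sup_{\theta\in B_{\hat\theta}(\delta')^{\mathsf c}}\Big\{\tfrac1n\log f_n(X^n|\theta)-\tfrac1n\log f_n(X^n|\hat\theta)\Big\}>-c\Big)<\epsilon.$$ (ALap) For $b:\mathbb R^p\to\mathbb R$: (1) $b$ is integrable on $\mathbb R^p$; (2) $b(\theta)$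 is finite in an open ball around $\theta^*$; (3) there exist a (possibly data-dependent) vector $v\in\mathbb R^p$ and a constant $M<\infty$ such that for all $\epsilon>0$ and some $\delta>0$ (for $n$ sufficiently large) $$\mathbb P_{f_{0,n}}\Big(\sup_{h\in\mathcal H_{n,b}}\Big\{|R_b(h)|-\frac{M}{\alpha_nn}\|h\|_2^2\Big\}>0\Big)<\epsilon,$$ where $\mathcal H_{n,b}=\{h\in\mathbb R^p:\|h\|_2/\sqrt{\alpha_nn}\le\delta\}$ and $R_b(h)=\big[b\big(\hat\theta+\tfrac{h}{\sqrt{\alpha_nn}}\big)-b(\hat\theta)\big]-\tfrac{v^\top h}{\sqrt{\alpha_nn}}$.
   Formalization: In (A2'), "positive definite with probability tending to one" is strengthened: for every ε, H_n lies in some compact set of symmetric positive definite matrices with probability above 1−ε for large n. If H_n may tend to 0 (e.g. like 1/log n), the claimed O(1/(α_n n)) rate fails. *)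

theory Defs
  imports "HOL-Probability.Probability"
begin

section \<open>Outer probability and stochastic orders\<close>

text \<open>
  The events in the hypotheses involve uncountable suprema and need not be measurable, and
  \<^const>\<open>emeasure\<close> is zero on non-measurable sets.  Probabilities of events are therefore outer
  probabilities; on measurable events these are the ordinary ones.
\<close>

definition prob_of :: "'w measure \<Rightarrow> ('w \<Rightarrow> bool) \<Rightarrow> ennreal" where
  "prob_of M Q = outer_measure_of M {x \<in> space M. Q x}"

definition bigO_prob ::
  "(nat \<Rightarrow> 'w measure) \<Rightarrow> (nat \<Rightarrow> 'w \<Rightarrow> 'v::real_normed_vector) \<Rightarrow> (nat \<Rightarrow> real) \<Rightarrow> bool" where
  "bigO_prob P Y a \<longleftrightarrow>
     (\<forall>\<epsilon>>0. \<exists>M>0. \<forall>\<^sub>F n in sequentially.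
        prob_of (P n) (\<lambda>x. norm (Y n x /\<^sub>R a n) > M) < ennreal \<epsilon>)"

definition tendsto_in_prob ::
  "(nat \<Rightarrow> 'w measure) \<Rightarrow> (nat \<Rightarrow> 'w \<Rightarrow> 'v::metric_space) \<Rightarrow> 'v \<Rightarrow> bool" where
  "tendsto_in_prob P Y c \<longleftrightarrow>
     (\<forall>\<epsilon>>0. (\<lambda>n. prob_of (P n) (\<lambda>x. dist (Y n x) c > \<epsilon>)) \<longlonglongrightarrow> 0)"

definition weak_conv_law ::
  "(nat \<Rightarrow> 'v::topological_space measure) \<Rightarrow> 'v measure \<Rightarrow> bool" where
  "weak_conv_law N N' \<longleftrightarrow>
     (\<forall>g :: 'v \<Rightarrow> real. continuous_on UNIV g \<and> bounded (range g) \<longrightarrow>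
        (\<lambda>n. LINT y|N n. g y) \<longlonglongrightarrow> (LINT y|N'. g y))"

text \<open>
  The normal law with mean \<open>m\<close> and covariance matrix \<open>A A\<^sup>T\<close>.  Every symmetric positive
  semidefinite matrix is of this form.
\<close>

definition normal_law :: "real^'p \<Rightarrow> real^'p^'p \<Rightarrow> (real^'p) measure" where
  "normal_law m A =
     distr (density lborel (\<lambda>z :: real^'p. ennreal (\<Prod>i\<in>UNIV. std_normal_density (z $ i))))
       borel (\<lambda>z. m + A *v z)"

definition asymp_normal :: "(nat \<Rightarrow> 'w measure) \<Rightarrow> (nat \<Rightarrow> 'w \<Rightarrow> real^'p) \<Rightarrow> bool" where
  "asymp_normal P Z \<longleftrightarrow>
     (\<exists>m A. weak_conv_law (\<lambda>n. distr (P n) borel (Z n)) (normal_law m A))"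


section \<open>Samples, densities and posteriors\<close>

definition is_density :: "'w measure \<Rightarrow> ('w \<Rightarrow> real) \<Rightarrow> bool" where
  "is_density M g \<longleftrightarrow>
     g \<in> borel_measurable M \<and> (\<forall>x\<in>space M. 0 \<le> g x) \<and> (\<integral>\<^sup>+x. ennreal (g x) \<partial>M) = 1"

text \<open>
  A sample \<open>(X\<^sub>1, \<dots>, X\<^sub>n)\<close> is a function on \<open>{..<n}\<close> with values in \<open>\<X>\<close>.  Densities are taken with
  respect to the \<open>n\<close>-fold product of an arbitrary dominating measure \<open>\<mu>\<close> on \<open>\<real>\<^sup>d\<close> restricted
  to \<open>\<X>\<close>, for instance Lebesgue measure.  The density of a sample is a joint density; the
  components need not be independent.
\<close>

definition sample_measure ::
  "(real^'d) measure \<Rightarrow> (real^'d) set \<Rightarrow> nat \<Rightarrow> (nat \<Rightarrow> real^'d) measure" where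
  "sample_measure \<mu> \<X> n = PiM {..<n} (\<lambda>_. restrict_space \<mu> \<X>)"

definition true_law ::
  "(real^'d) measure \<Rightarrow> (real^'d) set \<Rightarrow> (nat \<Rightarrow> (nat \<Rightarrow> real^'d) \<Rightarrow> real) \<Rightarrow>
   nat \<Rightarrow> (nat \<Rightarrow> real^'d) measure" where
  "true_law \<mu> \<X> f0 n = density (sample_measure \<mu> \<X> n) (\<lambda>x. ennreal (f0 n x))"

definition statistical_model ::
  "(real^'d) measure \<Rightarrow> (real^'d) set \<Rightarrow> (nat \<Rightarrow> (nat \<Rightarrow> real^'d) \<Rightarrow> real) \<Rightarrow>
   (real^'p) set \<Rightarrow> (nat \<Rightarrow> (nat \<Rightarrow> real^'d) \<Rightarrow> real^'p \<Rightarrow> real) \<Rightarrow> bool" where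
  "statistical_model \<mu> \<X> f0 \<Theta> f \<longleftrightarrow>
     sigma_finite_measure \<mu> \<and> sets \<mu> = sets borel \<and> \<X> \<in> sets borel \<and>
     (\<forall>n>0. is_density (sample_measure \<mu> \<X> n) (f0 n) \<and>
            (\<forall>\<theta>\<in>\<Theta>. is_density (sample_measure \<mu> \<X> n) (\<lambda>x. f n x \<theta>)) \<and>
            (\<forall>x\<in>space (sample_measure \<mu> \<X> n). set_borel_measurable borel \<Theta> (f n x)))"

text \<open>
  Below, \<open>L\<close> stands for the likelihood \<open>\<theta> \<mapsto> f\<^sub>n(X\<^sup>n|\<theta>)\<close>.  The term \<open>L \<theta> powr \<alpha>\<close> is
  \<open>exp (\<alpha> ln (L \<theta>))\<close> if \<open>L \<theta> > 0\<close>, and \<open>0\<close> if \<open>L \<theta> = 0\<close>.  Integrating over \<open>\<Theta>\<close> encodes the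
  convention that integrands vanish outside \<open>\<Theta>\<close>.
\<close>

definition evidence :: "(real^'p) set \<Rightarrow> (real^'p \<Rightarrow> real) \<Rightarrow> (real^'p \<Rightarrow> real) \<Rightarrow> real \<Rightarrow> real" where
  "evidence \<Theta> \<pi> L \<alpha> = (LINT \<theta>:\<Theta>|lborel. L \<theta> powr \<alpha> * \<pi> \<theta>)"

definition alpha_posterior ::
  "(real^'p) set \<Rightarrow> (real^'p \<Rightarrow> real) \<Rightarrow> (real^'p \<Rightarrow> real) \<Rightarrow> real \<Rightarrow> real^'p \<Rightarrow> real" where
  "alpha_posterior \<Theta> \<pi> L \<alpha> \<theta> = L \<theta> powr \<alpha> * \<pi> \<theta> / evidence \<Theta> \<pi> L \<alpha>"

definition proper_posterior ::
  "(real^'p) set \<Rightarrow> (real^'p \<Rightarrow> real) \<Rightarrow> (real^'p \<Rightarrow> real) \<Rightarrow> real \<Rightarrow> bool" where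
  "proper_posterior \<Theta> \<pi> L \<alpha> \<longleftrightarrow>
     set_integrable lborel \<Theta> (\<lambda>\<theta>. L \<theta> powr \<alpha> * \<pi> \<theta>) \<and> evidence \<Theta> \<pi> L \<alpha> > 0"

definition posterior_mean ::
  "(real^'p) set \<Rightarrow> (real^'p \<Rightarrow> real) \<Rightarrow> (real^'p \<Rightarrow> real) \<Rightarrow> real \<Rightarrow> (real^'p \<Rightarrow> real) \<Rightarrow> real" where
  "posterior_mean \<Theta> \<pi> L \<alpha> q = (LINT \<theta>:\<Theta>|lborel. q \<theta> * alpha_posterior \<Theta> \<pi> L \<alpha> \<theta>)"

text \<open>
  The log-likelihood is extended-real valued, since \<^term>\<open>ln (0::real)\<close> is \<open>0\<close>.  It is
  \<open>-\<infinity>\<close> where the likelihood vanishes and outside \<open>\<Theta>\<close>.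
\<close>

definition loglik :: "(real^'p) set \<Rightarrow> (real^'p \<Rightarrow> real) \<Rightarrow> real^'p \<Rightarrow> ereal" where
  "loglik \<Theta> L \<theta> = (if \<theta> \<in> \<Theta> \<and> 0 < L \<theta> then ereal (ln (L \<theta>)) else -\<infinity>)"


section \<open>The assumptions\<close>

definition C2_on :: "(real^'p) set \<Rightarrow> (real^'p \<Rightarrow> real) \<Rightarrow> bool" where
  "C2_on U g \<longleftrightarrow>
     (\<exists>(D :: real^'p \<Rightarrow> real^'p) (D2 :: real^'p \<Rightarrow> real^'p^'p).
        (\<forall>\<theta>\<in>U. (g has_derivative (\<lambda>h. D \<theta> \<bullet> h)) (at \<theta>) \<and>
                (D has_derivative (\<lambda>h. D2 \<theta> *v h)) (at \<theta>)) \<and>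
        continuous_on U D2)"

definition pos_def :: "real^'p^'p \<Rightarrow> bool" where
  "pos_def A \<longleftrightarrow> transpose A = A \<and> (\<forall>h. h \<noteq> 0 \<longrightarrow> 0 < h \<bullet> (A *v h))"

definition tensor3 :: "real^'p^'p^'p \<Rightarrow> real^'p \<Rightarrow> real" where
  "tensor3 S h = (\<Sum>i\<in>UNIV. \<Sum>j\<in>UNIV. \<Sum>k\<in>UNIV. S $ i $ j $ k * h $ i * h $ j * h $ k)"

definition assm_A0 ::
  "(nat \<Rightarrow> 'w measure) \<Rightarrow> (real^'p) set \<Rightarrow> (nat \<Rightarrow> 'w \<Rightarrow> real^'p \<Rightarrow> real) \<Rightarrow>
   (nat \<Rightarrow> 'w \<Rightarrow> real^'p) \<Rightarrow> real^'p \<Rightarrow> bool" where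
  "assm_A0 P \<Theta> f \<theta>hat \<theta>star \<longleftrightarrow>
     open \<Theta> \<and> \<theta>star \<in> \<Theta> \<and>
     (\<forall>n>0. \<theta>hat n \<in> borel_measurable (P n) \<and>
            (AE x in P n. \<forall>\<theta>. is_arg_max (f n x) (\<lambda>\<theta>. \<theta> \<in> \<Theta>) \<theta> \<longleftrightarrow> \<theta> = \<theta>hat n x)) \<and>
     tendsto_in_prob P \<theta>hat \<theta>star \<and>
     asymp_normal P (\<lambda>n x. sqrt (real n) *\<^sub>R (\<theta>hat n x - \<theta>star))"

definition assm_A1 :: "(real^'p) set \<Rightarrow> (real^'p \<Rightarrow> real) \<Rightarrow> real^'p \<Rightarrow> bool" where
  "assm_A1 \<Theta> \<pi> \<theta>star \<longleftrightarrow>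
     (\<exists>r>0. (\<forall>\<theta>\<in>ball \<theta>star r. 0 < \<pi> \<theta>) \<and> C2_on (ball \<theta>star r) \<pi>) \<and>
     set_integrable lborel \<Theta> (\<lambda>\<theta>. \<pi> \<theta> *\<^sub>R \<theta>)"

text \<open>
  For a sequence of random matrices whose law changes with \<open>n\<close>, positive definiteness with
  probability tending to one is read as non-degenerate in the limit: up to arbitrarily small
  probability the matrices stay in a compact set of symmetric positive definite matrices.  In
  particular the probability that \<open>H n\<close> is positive definite tends to one.  This is
  deliberately stronger than that consequence alone, which does not suffice for an expansion with
  error \<open>O(1 / (\<alpha>\<^sub>n n))\<close>: if \<open>p = 1\<close> and \<open>H n\<close> tends to zero, the quartic term of the
  log-likelihood contributes a relative error of order \<open>1 / (\<alpha>\<^sub>n n (H n)\<^sup>2)\<close>, and if \<open>H n\<close> grows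
  exponentially, the mass of the peak at the maximum likelihood estimator need not dominate the
  mass away from it.
\<close>

definition pos_def_in_prob :: "(nat \<Rightarrow> 'w measure) \<Rightarrow> (nat \<Rightarrow> 'w \<Rightarrow> real^'p^'p) \<Rightarrow> bool" where
  "pos_def_in_prob P H \<longleftrightarrow>
     (\<forall>\<epsilon>>0. \<exists>K. compact K \<and> K \<subseteq> {A. pos_def A} \<and>
        (\<forall>\<^sub>F n in sequentially. prob_of (P n) (\<lambda>x. H n x \<notin> K) < ennreal \<epsilon>))"

text \<open>
  In the remainders, \<open>a\<close> stands for \<open>\<alpha>\<^sub>n\<close> and \<open>t\<close> for \<open>\<theta>hat\<close>.  The log-likelihood remainder is
  infinite, so the bound below fails, at points outside \<open>\<Theta>\<close> or of zero likelihood.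
\<close>

definition loglik_remainder ::
  "(real^'p) set \<Rightarrow> (real^'p \<Rightarrow> real) \<Rightarrow> real^'p \<Rightarrow> real^'p^'p \<Rightarrow> real^'p^'p^'p \<Rightarrow>
   real \<Rightarrow> nat \<Rightarrow> real^'p \<Rightarrow> ereal" where
  "loglik_remainder \<Theta> L t H S a n h =
     ereal a * (loglik \<Theta> L (t + h /\<^sub>R sqrt (a * real n)) - loglik \<Theta> L t)
     + ereal (h \<bullet> (H *v h) / 2 - tensor3 S h / (6 * sqrt (a * real n)))"

definition assm_A2 ::
  "(nat \<Rightarrow> 'w measure) \<Rightarrow> (real^'p) set \<Rightarrow> (nat \<Rightarrow> 'w \<Rightarrow> real^'p \<Rightarrow> real) \<Rightarrow>
   (nat \<Rightarrow> 'w \<Rightarrow> real^'p) \<Rightarrow> (nat \<Rightarrow> real) \<Rightarrow> (nat \<Rightarrow> 'w \<Rightarrow> real^'p^'p) \<Rightarrow> bool" where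
  "assm_A2 P \<Theta> f \<theta>hat \<alpha> H \<longleftrightarrow>
     pos_def_in_prob P H \<and>
     (\<exists>(S :: nat \<Rightarrow> 'w \<Rightarrow> real^'p^'p^'p) (M :: real). \<forall>\<epsilon>>0. \<exists>\<delta>>0. \<forall>\<^sub>F n in sequentially.
        prob_of (P n) (\<lambda>x.
          (SUP h\<in>{h. norm h / sqrt (\<alpha> n * real n) \<le> \<delta>}.
             \<bar>loglik_remainder \<Theta> (f n x) (\<theta>hat n x) (H n x) (S n x) (\<alpha> n) n h\<bar>
             - ereal (M / (\<alpha> n * real n) * norm h ^ 4)) > 0)
        < ennreal \<epsilon>)"

definition assm_A3 ::
  "(nat \<Rightarrow> 'w measure) \<Rightarrow> (real^'p) set \<Rightarrow> (nat \<Rightarrow> 'w \<Rightarrow> real^'p \<Rightarrow> real) \<Rightarrow>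
   (nat \<Rightarrow> 'w \<Rightarrow> real^'p) \<Rightarrow> bool" where
  "assm_A3 P \<Theta> f \<theta>hat \<longleftrightarrow>
     (\<forall>\<epsilon>>0. \<forall>\<delta>'>0. \<exists>c>0. \<forall>\<^sub>F n in sequentially.
        prob_of (P n) (\<lambda>x.
          (SUP \<theta>\<in>- ball (\<theta>hat n x) \<delta>'.
             ereal (1 / real n) * loglik \<Theta> (f n x) \<theta>
             - ereal (1 / real n) * loglik \<Theta> (f n x) (\<theta>hat n x)) > ereal (- c))
        < ennreal \<epsilon>)"

text \<open>
  Finiteness of \<open>b\<close> near \<open>\<theta>\<^sup>*\<close> needs no clause because \<open>b\<close> is real-valued.
\<close>

definition assm_Lap ::
  "(nat \<Rightarrow> 'w measure) \<Rightarrow> (real^'p) set \<Rightarrow> (nat \<Rightarrow> 'w \<Rightarrow> real^'p) \<Rightarrow> (nat \<Rightarrow> real) \<Rightarrow>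
   (real^'p \<Rightarrow> real) \<Rightarrow> bool" where
  "assm_Lap P \<Theta> \<theta>hat \<alpha> b \<longleftrightarrow>
     set_integrable lborel \<Theta> b \<and>
     (\<exists>(v :: nat \<Rightarrow> 'w \<Rightarrow> real^'p) (M :: real). \<forall>\<epsilon>>0. \<exists>\<delta>>0. \<forall>\<^sub>F n in sequentially.
        prob_of (P n) (\<lambda>x.
          (SUP h\<in>{h. norm h / sqrt (\<alpha> n * real n) \<le> \<delta>}.
             ereal (\<bar>b (\<theta>hat n x + h /\<^sub>R sqrt (\<alpha> n * real n)) - b (\<theta>hat n x)
                     - (v n x \<bullet> h) / sqrt (\<alpha> n * real n)\<bar>
                    - M / (\<alpha> n * real n) * (norm h)\<^sup>2)) > 0)
        < ennreal \<epsilon>)"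

end

theory Submission
  imports Defs
begin

text \<open>
  Write \<open>\<theta> = \<theta>hat + u\<close> and \<open>N = \<alpha> n\<close>.  The likelihood integral, divided by the power
  \<open>\<alpha>\<close> of the maximal likelihood, is the integral of \<open>b (\<theta>hat + u) exp (N g u)\<close>, where \<open>g u\<close> is the increment of the
  log-likelihood per observation.  Near \<open>0\<close> the exponent is \<open>N (- u \<bullet> H u / 2 + T u + O(\<bar>u\<bar>\<^sup>4))\<close> with a
  cubic form \<open>T\<close>, and \<open>b (\<theta>hat + u) = b \<theta>hat + v \<bullet> u + O(\<bar>u\<bar>\<^sup>2)\<close>.  Expanding the exponential
  to first order around the Gaussian \<open>exp (- N u \<bullet> H u / 2)\<close> leaves three kinds of terms:
  \<open>b \<theta>hat\<close> times the Gaussian, which gives the claimed main term;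
  the odd terms \<open>v \<bullet> u\<close> and \<open>b \<theta>hat N T u\<close>, which integrate to zero by symmetry;
  and terms of the form \<open>N\<^sup>j \<bar>u\<bar>\<^sup>2\<^sup>j\<^sup>+\<^sup>2\<close>, which the Gaussian turns into a relative error \<open>O(1 / N)\<close>.
  Away from \<open>0\<close> the integrand is smaller than \<open>exp (- c N)\<close> times an integrable function.
  This is \<open>laplace_integrand_bound\<close> (pointwise) and \<open>laplace_integral_bound\<close> (integrated).

  The error is uniform only if the coefficients are bounded, and the assumptions say nothing about
  the size of the cubic tensor, of \<open>v\<close> and of \<open>b \<theta>hat\<close>.  The bounds come for free.  The tensor is
  bounded because \<open>\<theta>hat\<close> maximises the likelihood: if its cubic form were large in some direction,
  the expansion would exceed its value at \<open>0\<close> there (\<open>tensor3_bounded_at_maximum\<close>).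
  The coefficients of \<open>b\<close> are bounded because a function that is almost affine on a ball with large
  coefficients has a large integral (\<open>expansion_coefficients_bounded\<close>).

  In the variable \<open>u\<close> the assumptions on the likelihood do not involve \<open>\<alpha>\<close>, because quadratic, cubic
  and quartic terms all carry the same factor \<open>N\<close>.  So on one event of probability close to one
  (\<open>regular_sample_likely\<close>) the expansion holds simultaneously for all exponents \<open>a\<close> with
  \<open>a n\<close> large, which covers a data-dependent exponent at once.  The posterior mean is the quotient of the integrals for
  \<open>b = q \<pi>\<close> and \<open>b = \<pi>\<close>, where the normalising factors cancel; the expansion for \<open>\<pi>\<close> is Taylor's theorem.
\<close>

section \<open>Linear changes of variables\<close>

text \<open>
  Lebesgue measure is the image of a product of one-dimensional Lebesgue measures.  Integrating over
  the coordinate \<open>m\<close> first, the shear becomes a translation of the real line.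
\<close>

lemma nn_integral_lborel_shift_coordinate:
  fixes f :: "real^'n \<Rightarrow> ennreal"
  assumes [measurable]: "f \<in> borel_measurable borel" and mn: "m \<noteq> n"
  shows "(\<integral>\<^sup>+x. f (\<chi> i. if i = m then x $ m + x $ n else x $ i) \<partial>lborel) = (\<integral>\<^sup>+x. f x \<partial>lborel)"
proof -
  define B where "B = (Basis :: (real^'n) set)"
  define em en :: "real^'n" where "em = axis m 1" and "en = axis n 1"
  define V :: "(real^'n \<Rightarrow> real) \<Rightarrow> real^'n" where "V = (\<lambda>g. \<Sum>b\<in>B. g b *\<^sub>R b)"
  define sh :: "real^'n \<Rightarrow> real^'n" where "sh = (\<lambda>x. \<chi> i. if i = m then x $ m + x $ n else x $ i)"
  have sh_alt: "sh x = x + (x \<bullet> en) *\<^sub>R em" for x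
    by (simp add: sh_def en_def em_def vec_eq_iff inner_axis) (simp add: axis_def)
  have [measurable]: "sh \<in> borel_measurable borel"
    unfolding sh_alt[abs_def] by measurable
  have emB: "em \<in> B" and enB: "en \<in> B" and ne: "en \<noteq> em"
    using mn by (auto simp: em_def en_def B_def axis_in_Basis_iff axis_eq_axis)
  have finB: "finite B" by (simp add: B_def)
  interpret product_sigma_finite "\<lambda>b::real^'n. lborel :: real measure"
    by standard
  let ?P = "\<lambda>I. Pi\<^sub>M I (\<lambda>b::real^'n. lborel :: real measure)"
  have lb: "lborel = distr (?P B) borel V"
    unfolding V_def B_def by (rule lborel_eq)
  have Vmeas[measurable]: "V \<in> borel_measurable (?P B)"
    unfolding V_def by measurable
  have Vsh: "sh (V (g(em := y))) = V (g(em := y + g en))" for g y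
  proof -
    have "V (g(em := z)) = z *\<^sub>R em + (\<Sum>b\<in>B - {em}. g b *\<^sub>R b)" for z
      unfolding V_def by (subst sum.remove[OF finB emB]) (auto intro!: sum.cong)
    moreover have "V (g(em := y)) \<bullet> en = g en"
      unfolding V_def B_def using enB ne
      by (subst inner_sum_left_Basis) (auto simp: B_def)
    ultimately show ?thesis
      by (simp add: sh_alt algebra_simps)
  qed
  have split: "(\<integral>\<^sup>+x. h x \<partial>lborel) = (\<integral>\<^sup>+g. (\<integral>\<^sup>+y. h (V (g(em := y))) \<partial>lborel) \<partial>?P (B - {em}))"
    if [measurable]: "h \<in> borel_measurable borel" for h :: "real^'n \<Rightarrow> ennreal"
    unfolding lb
    using product_nn_integral_insert[of "B - {em}" em "\<lambda>g. h (V g)"] finB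
    by (simp add: nn_integral_distr insert_absorb[OF emB])
  have "(\<integral>\<^sup>+x. f (sh x) \<partial>lborel) = (\<integral>\<^sup>+g. (\<integral>\<^sup>+y. f (V (g(em := g en + 1 * y))) \<partial>lborel) \<partial>?P (B - {em}))"
    by (subst split) (simp_all add: Vsh add.commute)
  also have "\<dots> = (\<integral>\<^sup>+g. (\<integral>\<^sup>+y. f (V (g(em := y))) \<partial>lborel) \<partial>?P (B - {em}))"
  proof (rule nn_integral_cong)
    fix g assume "g \<in> space (?P (B - {em}))"
    have "V (g(em := y)) = y *\<^sub>R em + (\<Sum>b\<in>B - {em}. g b *\<^sub>R b)" for y
      unfolding V_def by (subst sum.remove[OF finB emB]) (auto intro!: sum.cong)
    then have [measurable]: "(\<lambda>y. f (V (g(em := y)))) \<in> borel_measurable borel"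
      by simp
    show "(\<integral>\<^sup>+y. f (V (g(em := g en + 1 * y))) \<partial>lborel) = (\<integral>\<^sup>+y. f (V (g(em := y))) \<partial>lborel)"
      using nn_integral_real_affine[of "\<lambda>y. f (V (g(em := y)))" 1 "g en"] by simp
  qed
  also have "\<dots> = (\<integral>\<^sup>+x. f x \<partial>lborel)"
    by (subst split) simp_all
  finally show ?thesis by (simp add: sh_def)
qed

text \<open>
  The swap permutes the sides of a box, and boxes determine Lebesgue measure.
\<close>

lemma nn_integral_lborel_swap_coordinates:
  fixes f :: "real^'n \<Rightarrow> ennreal"
  assumes [measurable]: "f \<in> borel_measurable borel"
  shows "(\<integral>\<^sup>+x. f (\<chi> i. x $ Transposition.transpose m n i) \<partial>lborel) = (\<integral>\<^sup>+x. f x \<partial>lborel)"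
proof -
  let ?s = "\<lambda>x::real^'n. \<chi> i. x $ Transposition.transpose m n i"
  have ms[measurable]: "?s \<in> borel_measurable borel"
    by (intro borel_measurable_continuous_onI continuous_intros)
  have "lborel = distr lborel borel ?s"
  proof (rule lborel_eqI)
    fix l u :: "real^'n" assume le: "\<And>b. b \<in> Basis \<Longrightarrow> l \<bullet> b \<le> u \<bullet> b"
    have le': "l $ i \<le> u $ i" for i
      using le[of "axis i 1"] by (simp add: axis_in_Basis_iff inner_axis)
    have prod: "(\<Prod>b\<in>Basis. (u' - l') \<bullet> b) = (\<Prod>i\<in>UNIV. u' $ i - l' $ i)" for u' l' :: "real^'n"
      by (simp add: Basis_vec_def prod.UNION_disjoint axis_eq_axis inner_axis
          cart_eq_inner_axis[symmetric] prod.reindex inj_on_def)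
    have tt: "Transposition.transpose m n (Transposition.transpose m n i) = i" for i by simp
    have pre: "?s -` box l u \<inter> space lborel = box (?s l) (?s u)"
    proof (auto simp: mem_box_cart)
      fix x i assume *: "\<forall>i. l $ i < x $ Transposition.transpose m n i \<and> x $ Transposition.transpose m n i < u $ i"
      show "l $ Transposition.transpose m n i < x $ i" "x $ i < u $ Transposition.transpose m n i"
        using *[rule_format, of "Transposition.transpose m n i"] by auto
    next
      fix x i assume *: "\<forall>i. l $ Transposition.transpose m n i < x $ i \<and> x $ i < u $ Transposition.transpose m n i"
      show "l $ i < x $ Transposition.transpose m n i" "x $ Transposition.transpose m n i < u $ i"
        using *[rule_format, of "Transposition.transpose m n i"] by auto
    qed
    have "emeasure (distr lborel borel ?s) (box l u) = emeasure lborel (box (?s l) (?s u))"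
      using pre by (subst emeasure_distr) auto
    also have "\<dots> = (\<Prod>b\<in>Basis. (?s u - ?s l) \<bullet> b)"
      by (rule emeasure_lborel_box) (use le' in \<open>auto simp: Basis_vec_def inner_axis\<close>)
    also have "\<dots> = ennreal (\<Prod>i\<in>UNIV. u $ (Transposition.transpose m n i) - l $ (Transposition.transpose m n i))"
      by (simp add: prod)
    also have "(\<Prod>i\<in>UNIV. u $ (Transposition.transpose m n i) - l $ (Transposition.transpose m n i))
       = (\<Prod>i\<in>UNIV. u $ i - l $ i)"
      by (rule prod.reindex_bij_betw[where h="Transposition.transpose m n" and g="\<lambda>i. u $ i - l $ i"]) simp
    finally show "emeasure (distr lborel borel ?s) (box l u) = (\<Prod>b\<in>Basis. (u - l) \<bullet> b)"
      by (simp add: prod)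
  qed simp
  then have "(\<integral>\<^sup>+x. f x \<partial>lborel) = (\<integral>\<^sup>+x. f x \<partial>distr lborel borel ?s)" by simp
  then show ?thesis by (simp add: nn_integral_distr)
qed

lemma nn_integral_lborel_stretch:
  fixes f :: "real^'n \<Rightarrow> ennreal"
  assumes [measurable]: "f \<in> borel_measurable borel" and c: "\<And>i. c i \<noteq> 0"
  shows "ennreal \<bar>\<Prod>i\<in>UNIV. c i\<bar> * (\<integral>\<^sup>+x. f (\<chi> i. c i * x $ i) \<partial>lborel) = (\<integral>\<^sup>+x. f x \<partial>lborel)"
proof -
  define c' where "c' b = c (THE i. b = axis i (1::real))" for b :: "real^'n"
  have c': "c' (axis i 1) = c i" for i
    by (simp add: c'_def axis_eq_axis)
  have pr: "(\<Prod>j\<in>Basis. \<bar>c' j\<bar>) = (\<Prod>i\<in>UNIV. \<bar>c i\<bar>)"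
    by (simp add: Basis_vec_def prod.UNION_disjoint axis_eq_axis prod.reindex inj_on_def c')
  let ?T = "\<lambda>x::real^'n. 0 + (\<Sum>j\<in>Basis. (c' j * (x \<bullet> j)) *\<^sub>R j)"
  have T: "?T x = (\<chi> i. c i * x $ i)" for x
  proof (rule euclidean_eqI)
    fix b :: "real^'n" assume "b \<in> Basis"
    then obtain i where b: "b = axis i 1" by (auto simp: Basis_vec_def)
    show "?T x \<bullet> b = (\<chi> i. c i * x $ i) \<bullet> b"
      using \<open>b \<in> Basis\<close> inner_sum_left_Basis[of b "\<lambda>j. c' j * (x \<bullet> j)"]
      by (simp add: b c' inner_axis)
  qed
  have [measurable]: "(\<lambda>x::real^'n. \<chi> i. c i * x $ i) \<in> borel_measurable borel"
    by (intro borel_measurable_continuous_onI continuous_intros)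
  have "lborel = density (distr lborel borel ?T) (\<lambda>_. (\<Prod>j\<in>Basis. \<bar>c' j\<bar>))"
    by (rule lborel_affine_euclidean) (use c in \<open>auto simp: Basis_vec_def c'\<close>)
  then have "(\<integral>\<^sup>+x. f x \<partial>lborel) = (\<integral>\<^sup>+x. f x \<partial>density (distr lborel borel ?T) (\<lambda>_. (\<Prod>j\<in>Basis. \<bar>c' j\<bar>)))"
    by simp
  also have "\<dots> = ennreal (\<Prod>i\<in>UNIV. \<bar>c i\<bar>) * (\<integral>\<^sup>+x. f (\<chi> i. c i * x $ i) \<partial>lborel)"
    unfolding T by (simp add: nn_integral_density nn_integral_distr nn_integral_cmult pr)
  finally show ?thesis by (simp add: abs_prod)
qed

text \<open>
  Every matrix is a product of elementary ones and the determinant is multiplicative, so only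
  shears, swaps and diagonal matrices remain.
\<close>

lemma nn_integral_lborel_linear:
  fixes f :: "real^'n \<Rightarrow> ennreal" and A :: "real^'n^'n"
  assumes "f \<in> borel_measurable borel" "det A \<noteq> 0"
  shows "ennreal \<bar>det A\<bar> * (\<integral>\<^sup>+x. f (A *v x) \<partial>lborel) = (\<integral>\<^sup>+x. f x \<partial>lborel)"
proof -
  have [measurable]: "(*v) A \<in> borel_measurable borel" for A :: "real^'n^'n"
    by (intro borel_measurable_continuous_onI matrix_vector_mult_linear_continuous_on)
  have "\<forall>f. f \<in> borel_measurable borel \<longrightarrow> det A \<noteq> 0 \<longrightarrow>
    ennreal \<bar>det A\<bar> * (\<integral>\<^sup>+x. f (A *v x) \<partial>lborel) = (\<integral>\<^sup>+x. f x \<partial>lborel)"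
  proof (rule induct_matrix_elementary_alt[of _ A], goal_cases)
    case mult: (1 A B)
    show ?case
    proof (intro allI impI)
      fix f :: "real^'n \<Rightarrow> ennreal"
      assume [measurable]: "f \<in> borel_measurable borel" and d: "det (A ** B) \<noteq> 0"
      have nz: "det A \<noteq> 0" "det B \<noteq> 0" using d by (auto simp: det_mul)
      have "ennreal \<bar>det B\<bar> * (\<integral>\<^sup>+x. f (A *v (B *v x)) \<partial>lborel) = (\<integral>\<^sup>+x. f (A *v x) \<partial>lborel)"
        using mult(2)[rule_format, of "\<lambda>x. f (A *v x)"] nz by simp
      moreover have "ennreal \<bar>det A\<bar> * (\<integral>\<^sup>+x. f (A *v x) \<partial>lborel) = (\<integral>\<^sup>+x. f x \<partial>lborel)"
        using mult(1)[rule_format, of f] nz by simp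
      ultimately show "ennreal \<bar>det (A ** B)\<bar> * (\<integral>\<^sup>+x. f ((A ** B) *v x) \<partial>lborel) = (\<integral>\<^sup>+x. f x \<partial>lborel)"
        by (simp add: det_mul abs_mult ennreal_mult mult.assoc matrix_vector_mul_assoc[symmetric])
    qed
  next
    case zero_row: (2 A i)
    then show ?case using det_zero_row(2)[of i A] by simp
  next
    case diagonal: (3 A)
    have dA: "det A = (\<Prod>i\<in>UNIV. A $ i $ i)" by (rule det_diagonal) (rule diagonal)
    have "A *v x = (\<chi> i. A $ i $ i * x $ i)" for x
    proof -
      have "(\<Sum>j\<in>UNIV. A $ i $ j * x $ j) = A $ i $ i * x $ i" for i
        by (subst sum.remove[of _ i]) (auto simp: diagonal)
      then show ?thesis by (simp add: matrix_vector_mult_def)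
    qed
    then show ?case
      using nn_integral_lborel_stretch[of _ "\<lambda>i. A $ i $ i"] by (auto simp: dA)
  next
    case swap1: (4 m n)
    let ?A = "\<chi> i j. mat 1 $ i $ Transposition.transpose m n j :: real^'n^'n"
    have d: "det ?A = - 1"
      using det_permute_columns[of "Transposition.transpose m n" "mat 1 :: real^'n^'n"] swap1
      by (simp add: permutes_swap_id sign_swap_id)
    have "?A *v x = (\<chi> i. x $ Transposition.transpose m n i)" for x
    proof -
      have "(\<Sum>j\<in>UNIV. (mat 1 :: real^'n^'n) $ i $ Transposition.transpose m n j * x $ j) = x $ Transposition.transpose m n i" for i
      proof -
        have "(mat 1 :: real^'n^'n) $ i $ Transposition.transpose m n j * x $ j
            = (if j = Transposition.transpose m n i then x $ j else 0)" for j
          by (auto simp: mat_def transpose_eq_iff)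
        then show ?thesis by simp
      qed
      then show ?thesis by (simp add: matrix_vector_mult_def)
    qed
    then show ?case
      using nn_integral_lborel_swap_coordinates[of _ m n] by (auto simp: d simp del: of_bool_or_iff)
  next
    case idplus: (5 m n)
    let ?A = "\<chi> i j. of_bool (i = m \<and> j = n \<or> i = j) :: real^'n^'n"
    have "?A = (\<chi> k. if k = m then row m (mat 1) + 1 *s row n (mat 1) else row k (mat 1))"
      using idplus by (auto simp: vec_eq_iff row_def mat_def)
    then have d: "det ?A = 1"
      using det_row_operation[OF idplus, of "mat 1 :: real^'n^'n" 1] by simp
    have "?A *v x = (\<chi> i. if i = m then x $ m + x $ n else x $ i)" for x
    proof -
      have "(\<Sum>j\<in>UNIV. of_bool (i = m \<and> j = n \<or> i = j) * x $ j) = (if i = m then x $ m + x $ n else x $ i)" for i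
      proof -
        have "of_bool (i = m \<and> j = n \<or> i = j) * x $ j
           = (if j = i then x $ j else 0) + (if j = n then (if i = m then x $ j else 0) else 0)" for j
          using idplus by auto
        then show ?thesis by (simp add: sum.distrib)
      qed
      then show ?thesis by (simp add: matrix_vector_mult_def)
    qed
    then show ?case
      using nn_integral_lborel_shift_coordinate[OF _ idplus] by (auto simp: d simp del: of_bool_or_iff)
  qed
  with assms show ?thesis by blast
qed

section \<open>Gaussian integrals\<close>

lemma has_bochner_integral_gaussian_norm:
  assumes "0 < \<kappa>"
  shows "has_bochner_integral lborel (\<lambda>u::real^'n. exp (- (\<kappa> * (norm u)\<^sup>2)))
           ((pi / \<kappa>) powr (real CARD('n) / 2))"
proof -
  have one: "(\<integral>\<^sup>+x. ennreal (exp (- (\<kappa> * x\<^sup>2))) \<partial>lborel) = ennreal (sqrt (pi / \<kappa>))"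
  proof -
    define \<sigma> where "\<sigma> = sqrt (1 / (2 * \<kappa>))"
    have s: "\<sigma> > 0" "\<sigma>\<^sup>2 = 1 / (2 * \<kappa>)" using assms by (simp_all add: \<sigma>_def)
    have "2 * pi * \<sigma>\<^sup>2 = pi / \<kappa>" "x\<^sup>2 / (2 * \<sigma>\<^sup>2) = \<kappa> * x\<^sup>2" for x
      using assms by (simp_all add: s(2))
    then have e: "exp (- (\<kappa> * x\<^sup>2)) = sqrt (pi / \<kappa>) * normal_density 0 \<sigma> x" for x
      using assms by (simp add: normal_density_def)
    have "(\<integral>\<^sup>+x. ennreal (exp (- (\<kappa> * x\<^sup>2))) \<partial>lborel)
       = ennreal (sqrt (pi / \<kappa>)) * (\<integral>\<^sup>+x. ennreal (normal_density 0 \<sigma> x) \<partial>lborel)"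
      unfolding e using assms by (subst ennreal_mult) (simp_all add: nn_integral_cmult)
    also have "(\<integral>\<^sup>+x. ennreal (normal_density 0 \<sigma> x) \<partial>lborel) = 1"
      using s by (subst nn_integral_eq_integral) auto
    finally show ?thesis by simp
  qed
  have prod: "exp (- (\<kappa> * (norm u)\<^sup>2)) = (\<Prod>b\<in>Basis. exp (- (\<kappa> * (u \<bullet> b)\<^sup>2)))" for u :: "real^'n"
    by (subst euclidean_inner[of u u, folded power2_norm_eq_inner])
       (simp add: exp_sum power2_eq_square sum_distrib_left flip: sum_negf)
  have "(\<integral>\<^sup>+u. ennreal (exp (- (\<kappa> * (norm (u::real^'n))\<^sup>2))) \<partial>lborel)
      = (\<integral>\<^sup>+u. (\<Prod>b\<in>Basis. ennreal (exp (- (\<kappa> * ((u::real^'n) \<bullet> b)\<^sup>2)))) \<partial>lborel)"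
    by (simp add: prod prod_ennreal)
  also have "\<dots> = (\<Prod>b\<in>(Basis :: (real^'n) set). ennreal (sqrt (pi / \<kappa>)))"
    by (subst nn_integral_lborel_prod) (simp_all add: one)
  also have "\<dots> = ennreal (sqrt (pi / \<kappa>) ^ CARD('n))"
    using assms by (simp add: ennreal_power)
  also have "sqrt (pi / \<kappa>) ^ CARD('n) = (pi / \<kappa>) powr (real CARD('n) / 2)"
    using assms by (simp add: powr_half_sqrt[symmetric] powr_powr powr_realpow[symmetric])
  finally show ?thesis
    by (intro has_bochner_integral_nn_integral) auto
qed

text \<open>
  Gram--Schmidt for the inner product \<open>x \<bullet> (A *v y)\<close>: as long as there are fewer than \<open>n\<close> vectors,
  some nonzero \<open>z\<close> is orthogonal to all \<open>A *v w i\<close>, and it can be normalised.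
\<close>

lemma pos_def_orthonormal_frame:
  fixes A :: "real^'n^'n"
  assumes "pos_def A"
  obtains w :: "'n \<Rightarrow> real^'n" where "\<And>i j. w i \<bullet> (A *v w j) = of_bool (i = j)"
proof -
  have symA: "x \<bullet> (A *v y) = y \<bullet> (A *v x)" for x y
  proof -
    have "transpose A = A" using assms by (simp add: pos_def_def)
    then have "x v* A = A *v x" using transpose_matrix_vector[of A x] by simp
    then show ?thesis using dot_lmul_matrix[of x A y] by (simp add: inner_commute)
  qed
  have "\<exists>w. \<forall>i\<in>I. \<forall>j\<in>I. w i \<bullet> (A *v w j) = of_bool (i = j)" for I :: "'n set"
  proof (induction I rule: finite_induct[OF finite])
    case (2 k I)
    then obtain w where w: "\<forall>i\<in>I. \<forall>j\<in>I. w i \<bullet> (A *v w j) = of_bool (i = j)" by blast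
    have "dim ((\<lambda>i. A *v w i) ` I) \<le> card I"
      using dim_le_card'[of "(\<lambda>i. A *v w i) ` I"] card_image_le[OF 2(1), of "\<lambda>i. A *v w i"] 2(1) by simp
    also have "card I < CARD('n)"
      using 2(2) by (intro psubset_card_mono) auto
    finally have "dim ((\<lambda>i. A *v w i) ` I) < DIM(real^'n)" by simp
    then obtain z where z: "z \<noteq> 0" "\<And>y. y \<in> span ((\<lambda>i. A *v w i) ` I) \<Longrightarrow> orthogonal z y"
      using orthogonal_to_subspace_exists by blast
    have z0: "z \<bullet> (A *v w i) = 0" if "i \<in> I" for i
      using z(2)[of "A *v w i"] that by (auto simp: orthogonal_def intro: span_base)
    define c where "c = z \<bullet> (A *v z)"
    have c: "c > 0" using assms z(1) by (simp add: c_def pos_def_def)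
    let ?w = "w(k := z /\<^sub>R sqrt c)"
    have zz: "(z /\<^sub>R sqrt c) \<bullet> (A *v (z /\<^sub>R sqrt c)) = 1"
      using c by (simp add: matrix_vector_mult_scaleR flip: c_def) (simp add: field_simps)
    have zw: "(z /\<^sub>R sqrt c) \<bullet> (A *v w i) = 0" "w i \<bullet> (A *v (z /\<^sub>R sqrt c)) = 0" if "i \<in> I" for i
      using z0[OF that] symA[of "w i" z] by (simp_all add: matrix_vector_mult_scaleR)
    have "?w i \<bullet> (A *v ?w j) = of_bool (i = j)" if "i \<in> insert k I" "j \<in> insert k I" for i j
    proof (cases "i = k"; cases "j = k")
      assume "i \<noteq> k" "j \<noteq> k"
      then show ?thesis using w that by simp
    qed (use that zz zw in auto)
    then show ?case by blast
  qed auto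
  from this[of UNIV] obtain w :: "'n \<Rightarrow> real^'n"
    where "\<And>i j. w i \<bullet> (A *v w j) = of_bool (i = j)" by auto
  then show ?thesis by (rule that)
qed

lemma pos_def_congruent_mat_1:
  fixes A :: "real^'n^'n"
  assumes "pos_def A"
  obtains W :: "real^'n^'n" where "transpose W ** A ** W = mat 1" 
proof -
  obtain w :: "'n \<Rightarrow> real^'n" where w: "\<And>i j. w i \<bullet> (A *v w j) = of_bool (i = j)"
    using pos_def_orthonormal_frame[OF assms] by blast
  define W :: "real^'n^'n" where "W = (\<chi> i j. w j $ i)"
  have "(transpose W ** A ** W) $ i $ j = w i \<bullet> (A *v w j)" for i j
    unfolding matrix_mul_assoc[symmetric]
    by (simp add: matrix_matrix_mult_def transpose_def W_def inner_vec_def matrix_vector_mult_def)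
  then have "transpose W ** A ** W = mat 1"
    by (simp add: w vec_eq_iff mat_def)
  then show ?thesis by (rule that)
qed

text \<open>
  If \<open>W\<^sup>T A W = 1\<close>, then \<open>u = W x\<close> turns the quadratic form of \<open>A\<close> into the squared norm, and taking
  determinants gives \<open>\<bar>det W\<bar> = (det A)\<^sup>-\<^sup>1\<^sup>/\<^sup>2\<close>.
\<close>

lemma det_pos_def: "pos_def (A :: real^'n^'n) \<Longrightarrow> 0 < det A"
  and gaussian_integral:
  "pos_def (A :: real^'n^'n) \<Longrightarrow> 0 < N \<Longrightarrow>
    has_bochner_integral lborel (\<lambda>u. exp (- (N * (u \<bullet> (A *v u)) / 2)))
      (det A powr (- 1 / 2) * (2 * pi / N) powr (real CARD('n) / 2))"
proof -
  assume "pos_def A"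
  then obtain W :: "real^'n^'n" where W: "transpose W ** A ** W = mat 1"
    by (rule pos_def_congruent_mat_1)
  have "det (transpose W ** A ** W) = 1" by (simp add: W)
  then have d: "det A * (det W)\<^sup>2 = 1" by (simp add: det_mul power2_eq_square algebra_simps)
  then have W0: "det W \<noteq> 0" by auto
  show dA: "0 < det A" using d W0 by (metis zero_less_mult_pos2 zero_less_one zero_less_power2)
  assume N: "0 < N"
  have q: "(W *v u) \<bullet> (A *v (W *v u)) = (norm u)\<^sup>2" for u
  proof -
    have "(W *v u) \<bullet> (A *v (W *v u)) = u \<bullet> ((transpose W ** A ** W) *v u)"
      using dot_lmul_matrix[of "A *v (W *v u)" W u]
      by (simp add: matrix_vector_mul_assoc[symmetric] inner_commute)
    then show ?thesis by (simp add: W power2_norm_eq_inner)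
  qed
  have [measurable]: "(*v) A \<in> borel_measurable borel"
    by (intro borel_measurable_continuous_onI matrix_vector_mult_linear_continuous_on)
  have "ennreal \<bar>det W\<bar> * (\<integral>\<^sup>+u. ennreal (exp (- (N * ((W *v u) \<bullet> (A *v (W *v u))) / 2))) \<partial>lborel)
     = (\<integral>\<^sup>+u. ennreal (exp (- (N * (u \<bullet> (A *v u)) / 2))) \<partial>lborel)"
    by (rule nn_integral_lborel_linear) (use W0 in auto)
  moreover have "(\<integral>\<^sup>+u. ennreal (exp (- (N * (norm (u::real^'n))\<^sup>2 / 2))) \<partial>lborel)
     = ennreal ((2 * pi / N) powr (real CARD('n) / 2))"
    using has_bochner_integral_gaussian_norm[of "N / 2", where 'n='n] N
    by (subst nn_integral_eq_integral)
       (auto simp: has_bochner_integral_iff mult.commute)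
  moreover have "\<bar>det W\<bar> = det A powr (- 1 / 2)"
  proof -
    have "(det W)\<^sup>2 = inverse (det A)" using d dA by (simp add: field_simps)
    then have "\<bar>det W\<bar> = sqrt (inverse (det A))" by (metis real_sqrt_abs)
    then show ?thesis using dA by (simp add: powr_minus powr_half_sqrt real_sqrt_inverse)
  qed
  ultimately have "(\<integral>\<^sup>+u. ennreal (exp (- (N * (u \<bullet> (A *v u)) / 2))) \<partial>lborel)
     = ennreal (det A powr (- 1 / 2) * (2 * pi / N) powr (real CARD('n) / 2))"
    by (simp add: q ennreal_mult)
  then show "has_bochner_integral lborel (\<lambda>u. exp (- (N * (u \<bullet> (A *v u)) / 2)))
      (det A powr (- 1 / 2) * (2 * pi / N) powr (real CARD('n) / 2))"
    by (intro has_bochner_integral_nn_integral) auto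
qed

section \<open>The Laplace integral around a fixed centre\<close>

lemma lborel_distr_reflect: "distr lborel borel (uminus :: 'a::euclidean_space \<Rightarrow> 'a) = lborel"
proof -
  have "lborel = density (distr lborel borel (\<lambda>x::'a. 0 + (- 1) *\<^sub>R x)) (\<lambda>_. ennreal (\<bar>- 1\<bar> ^ DIM('a)))"
    by (rule lborel_affine) simp
  then show ?thesis by (simp add: density_1)
qed

lemma integral_lborel_odd_eq_0:
  fixes f :: "'a::euclidean_space \<Rightarrow> real"
  assumes [measurable]: "f \<in> borel_measurable borel" and odd: "\<And>x. f (- x) = - f x"
  shows "(LINT x|lborel. f x) = 0"
proof -
  have "(LINT x|lborel. f x) = (LINT x|distr lborel borel uminus. f x)"
    by (simp add: lborel_distr_reflect)
  also have "\<dots> = - (LINT x|lborel. f x)"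
    by (subst integral_distr) (simp_all add: odd)
  finally show ?thesis by simp
qed

lemma integral_lborel_translate:
  fixes f :: "'a::euclidean_space \<Rightarrow> real"
  assumes [measurable]: "f \<in> borel_measurable borel"
  shows "(LINT u|lborel. f (t + u)) = (LINT x|lborel. f x)"
  by (subst (2) lborel_distr_plus[of t, symmetric]) (simp add: integral_distr)

lemma integrable_lborel_translate:
  fixes f :: "'a::euclidean_space \<Rightarrow> real"
  assumes "integrable lborel f"
  shows "integrable lborel (\<lambda>u. f (t + u))"
proof -
  have [measurable]: "f \<in> borel_measurable borel" using assms by auto
  have "integrable (distr lborel borel ((+) t)) f"
    using assms by (simp add: lborel_distr_plus)
  then show ?thesis by (subst (asm) integrable_distr_eq) auto
qed

lemma power_times_exp_minus_le:
  fixes x k :: real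
  assumes "0 \<le> x" "0 < k"
  shows "x ^ n * exp (- (k * x)) \<le> fact n / k ^ n"
proof -
  have s: "summable (\<lambda>i. (k * x) ^ i /\<^sub>R fact i)" by (rule summable_exp_generic)
  have "(k * x) ^ n /\<^sub>R fact n \<le> exp (k * x)"
    unfolding exp_def using s assms
    by (intro order_trans[OF _ sum_le_suminf[of _ "{n}"]]) auto
  then have "(k * x) ^ n \<le> fact n * exp (k * x)"
    by (simp add: field_simps)
  then show ?thesis using assms by (simp add: exp_minus field_simps)
qed

lemma exp_minus_linear_part_bound:
  fixes z :: real
  shows "\<bar>exp z - 1 - z\<bar> \<le> z\<^sup>2 / 2 * exp \<bar>z\<bar>"
proof -
  obtain t where t: "\<bar>t\<bar> \<le> \<bar>z\<bar>" "exp z = (\<Sum>m<2. z ^ m / fact m) + exp t / fact 2 * z ^ 2"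
    using Maclaurin_exp_le[of z 2] by blast
  then have "exp z - 1 - z = z\<^sup>2 / 2 * exp t" by (simp add: numeral_2_eq_2)
  then have "\<bar>exp z - 1 - z\<bar> = z\<^sup>2 / 2 * exp t" by (simp only: abs_mult) simp
  also have "\<dots> \<le> z\<^sup>2 / 2 * exp \<bar>z\<bar>" using t(1) by (intro mult_left_mono) auto
  finally show ?thesis .
qed

text \<open>
  The pointwise estimate behind the Laplace expansion, in scalars: \<open>r\<close> is the norm of the
  displacement \<open>u\<close>, \<open>Q\<close> the quadratic form, \<open>\<tau>\<close> the cubic form, \<open>g\<close> the log-likelihood increment per
  observation, and \<open>l\<close> the linear part of \<open>\<beta>\<close>.  With \<open>s = N r\<^sup>2\<close>, every error term is bounded by
  a constant times \<open>s\<^sup>k / N\<close> times \<open>exp (- \<kappa> s / 4)\<close> with \<open>1 \<le> k \<le> 3\<close>.  Half of the exponential decay absorbs the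
  power of \<open>s\<close>, which is where the factors \<open>k! (8 / \<kappa>)\<^sup>k\<close> in the constant come from.
\<close>

lemma laplace_integrand_bound:
  fixes N \<kappa> r Q \<tau> g \<beta> \<beta>0 l M M' C V B \<delta> :: real
  assumes N: "0 < N" and \<kappa>: "0 < \<kappa>" and r: "0 \<le> r" "r \<le> \<delta>"
    and nonneg: "0 \<le> M" "0 \<le> C" "0 \<le> M'" "0 \<le> V" "0 \<le> B"
    and Q: "\<kappa> * r\<^sup>2 \<le> Q" and g: "\<bar>g + Q / 2 - \<tau>\<bar> \<le> M * r ^ 4" and \<tau>: "\<bar>\<tau>\<bar> \<le> C * r ^ 3"
    and \<delta>: "C * \<delta> + M * \<delta>\<^sup>2 \<le> \<kappa> / 4"
    and \<beta>: "\<bar>\<beta> - \<beta>0 - l\<bar> \<le> M' * r\<^sup>2" and l: "\<bar>l\<bar> \<le> V * r" and \<beta>0: "\<bar>\<beta>0\<bar> \<le> B"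
  defines "K \<equiv> M' * (8 / \<kappa>) + ((B + V * \<delta>) * M + V * C) * (2 * (8 / \<kappa>)\<^sup>2)
                 + (B + V * \<delta>) * (C + M * \<delta>)\<^sup>2 / 2 * (6 * (8 / \<kappa>) ^ 3)"
  shows "\<bar>\<beta> * exp (N * g) - \<beta>0 * exp (- (N * Q / 2)) - (l + \<beta>0 * (N * \<tau>)) * exp (- (N * Q / 2))\<bar>
           \<le> K / N * exp (- (\<kappa> / 8 * N * r\<^sup>2))" (is "?lhs \<le> _")
    and "g \<le> 0"
proof -
  define s where "s = N * r\<^sup>2"
  define \<rho> where "\<rho> = g + Q / 2 - \<tau>"
  define z where "z = N * (\<tau> + \<rho>)"
  define E where "E = exp (- (N * Q / 2))"
  define G where "G = exp (- (\<kappa> / 4 * s))"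
  have \<delta>0: "0 \<le> \<delta>" using r by simp
  have s0: "0 \<le> s" using N by (simp add: s_def)
  have E0: "0 < E" and G0: "0 < G" by (simp_all add: E_def G_def)
  have gz: "exp (N * g) = E * exp z"
    by (simp add: E_def z_def \<rho>_def exp_add[symmetric] algebra_simps)
  have \<tau>\<rho>: "\<bar>\<tau> + \<rho>\<bar> \<le> C * r ^ 3 + M * r ^ 4" using g \<tau> by (simp add: \<rho>_def)
  have r34: "C * r ^ 3 + M * r ^ 4 \<le> \<kappa> / 4 * r\<^sup>2"
  proof -
    have "C * r ^ 3 + M * r ^ 4 = (C * r + M * r\<^sup>2) * r\<^sup>2"
      by (simp add: algebra_simps power3_eq_cube power4_eq_xxxx power2_eq_square)
    also have "C * r + M * r\<^sup>2 \<le> C * \<delta> + M * \<delta>\<^sup>2"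
      using r nonneg by (intro add_mono mult_left_mono power_mono) auto
    finally show ?thesis using \<delta> by (meson mult_right_mono order_trans zero_le_power2)
  qed
  have r34': "C * r ^ 3 + M * r ^ 4 \<le> (C + M * \<delta>) * r ^ 3"
  proof -
    have "M * r ^ 4 = M * r * r ^ 3" by (simp add: power3_eq_cube power4_eq_xxxx)
    also have "\<dots> \<le> M * \<delta> * r ^ 3"
      using r nonneg by (intro mult_right_mono mult_left_mono) auto
    finally show ?thesis by (simp add: algebra_simps)
  qed
  show "g \<le> 0"
  proof -
    have "g = - Q / 2 + (\<tau> + \<rho>)" by (simp add: \<rho>_def)
    also have "\<dots> \<le> - (\<kappa> * r\<^sup>2) / 2 + \<kappa> / 4 * r\<^sup>2" using Q \<tau>\<rho> r34 by simp
    also have "\<dots> \<le> 0" using \<kappa> by simp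
    finally show ?thesis .
  qed
  have zs: "\<bar>z\<bar> \<le> \<kappa> / 4 * s"
  proof -
    have "\<bar>z\<bar> = N * \<bar>\<tau> + \<rho>\<bar>" using N by (simp add: z_def abs_mult)
    also have "\<dots> \<le> N * (\<kappa> / 4 * r\<^sup>2)" using N \<tau>\<rho> r34 by (intro mult_left_mono) auto
    finally show ?thesis by (simp add: s_def algebra_simps)
  qed
  have z2: "z\<^sup>2 \<le> (C + M * \<delta>)\<^sup>2 * s ^ 3 / N"
  proof -
    have "\<bar>z\<bar> \<le> N * ((C + M * \<delta>) * r ^ 3)"
      using N \<tau>\<rho> r34' by (simp add: z_def abs_mult)
    then have "z\<^sup>2 \<le> (N * ((C + M * \<delta>) * r ^ 3))\<^sup>2"
      by (metis abs_ge_zero power2_abs power_mono)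
    also have "\<dots> = (C + M * \<delta>)\<^sup>2 * s ^ 3 / N"
      using N by (simp add: s_def power_mult_distrib field_simps power2_eq_square power3_eq_cube)
    finally show ?thesis .
  qed
  have EG: "E * exp \<bar>z\<bar> \<le> G"
  proof -
    have "\<kappa> * s \<le> N * Q" using mult_left_mono[OF Q, of N] N by (simp add: s_def algebra_simps)
    then show ?thesis using zs by (simp add: E_def G_def exp_add[symmetric])
  qed
  have EG': "E \<le> G"
  proof -
    have "E * 1 \<le> E * exp \<bar>z\<bar>" using E0 by (intro mult_left_mono) auto
    then show ?thesis using EG by simp
  qed
  have gG: "exp (N * g) \<le> G"
  proof -
    have "E * exp z \<le> E * exp \<bar>z\<bar>" using E0 by (intro mult_left_mono) auto
    then show ?thesis using EG by (simp add: gz)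
  qed
  have t1: "\<bar>(\<beta> - \<beta>0 - l) * exp (N * g)\<bar> \<le> M' * s / N * G"
  proof -
    have "\<bar>(\<beta> - \<beta>0 - l) * exp (N * g)\<bar> \<le> (M' * r\<^sup>2) * G"
      unfolding abs_mult using \<beta> gG nonneg by (intro mult_mono) auto
    then show ?thesis using N by (simp add: s_def)
  qed
  have t2: "\<bar>(\<beta>0 + l) * (exp (N * g) - E * (1 + N * \<tau>))\<bar>
      \<le> (B + V * \<delta>) * (((C + M * \<delta>)\<^sup>2 * s ^ 3 / 2 + M * s\<^sup>2) / N * G)"
  proof -
    have a: "\<bar>\<beta>0 + l\<bar> \<le> B + V * \<delta>"
      using \<beta>0 l mult_left_mono[OF r(2) nonneg(4)] by linarith
    have "\<bar>exp (N * g) - E * (1 + N * \<tau>)\<bar> = \<bar>E * (exp z - 1 - z) + E * (N * \<rho>)\<bar>"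
      by (simp add: gz z_def algebra_simps)
    also have "\<dots> \<le> E * \<bar>exp z - 1 - z\<bar> + E * (N * \<bar>\<rho>\<bar>)"
      using E0 N by (intro order_trans[OF abs_triangle_ineq]) (simp add: abs_mult)
    also have "E * \<bar>exp z - 1 - z\<bar> \<le> z\<^sup>2 / 2 * (E * exp \<bar>z\<bar>)"
      using mult_left_mono[OF exp_minus_linear_part_bound[of z], of E] E0 by (simp add: algebra_simps)
    also have "\<dots> \<le> ((C + M * \<delta>)\<^sup>2 * s ^ 3 / N) / 2 * G"
      using z2 EG E0 s0 N by (intro mult_mono) auto
    also have "E * (N * \<bar>\<rho>\<bar>) \<le> G * (N * (M * r ^ 4))"
      using EG' g N G0 by (intro mult_mono) (auto simp: \<rho>_def)
    also have "N * (M * r ^ 4) = M * s\<^sup>2 / N"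
      using N by (simp add: s_def power2_eq_square power4_eq_xxxx)
    finally have b: "\<bar>exp (N * g) - E * (1 + N * \<tau>)\<bar> \<le> ((C + M * \<delta>)\<^sup>2 * s ^ 3 / 2 + M * s\<^sup>2) / N * G"
      by (simp add: add_divide_distrib algebra_simps)
    show ?thesis unfolding abs_mult using a b nonneg \<delta>0 by (intro mult_mono) auto
  qed
  have t3: "\<bar>l * (N * \<tau>) * E\<bar> \<le> V * C * s\<^sup>2 / N * G"
  proof -
    have "\<bar>l * (N * \<tau>) * E\<bar> = N * (\<bar>l\<bar> * \<bar>\<tau>\<bar>) * E" using N E0 by (simp add: abs_mult)
    also have "\<dots> \<le> N * ((V * r) * (C * r ^ 3)) * G"
      using N l \<tau> EG' E0 r nonneg by (intro mult_mono mult_left_mono) auto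
    also have "N * ((V * r) * (C * r ^ 3)) = V * C * s\<^sup>2 / N"
      using N by (simp add: s_def power2_eq_square power3_eq_cube)
    finally show ?thesis .
  qed
  \<comment> \<open>Here \<open>G\<close> is the square of \<open>exp (- \<kappa> s / 8)\<close>; one factor absorbs the power of \<open>s\<close>.\<close>
  have p: "s ^ k * G \<le> fact k * (8 / \<kappa>) ^ k * exp (- (\<kappa> / 8 * s))" for k
  proof -
    have "s ^ k * exp (- (\<kappa> / 8 * s)) \<le> fact k * (8 / \<kappa>) ^ k"
      using power_times_exp_minus_le[OF s0, of "\<kappa> / 8" k] \<kappa> by (simp add: power_divide)
    then have "s ^ k * exp (- (\<kappa> / 8 * s)) * exp (- (\<kappa> / 8 * s)) \<le> fact k * (8 / \<kappa>) ^ k * exp (- (\<kappa> / 8 * s))"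
      by (rule mult_right_mono) simp
    moreover have "exp (- (\<kappa> / 8 * s)) * exp (- (\<kappa> / 8 * s)) = G"
      by (simp add: G_def exp_add[symmetric])
    ultimately show ?thesis by (simp only: mult.assoc)
  qed
  let ?e = "exp (- (\<kappa> / 8 * s))"
  have "\<beta> * exp (N * g) - \<beta>0 * E - (l + \<beta>0 * (N * \<tau>)) * E
      = (\<beta> - \<beta>0 - l) * exp (N * g) + (\<beta>0 + l) * (exp (N * g) - E * (1 + N * \<tau>)) + l * (N * \<tau>) * E"
    by (simp add: algebra_simps)
  then have "?lhs \<le> M' * s / N * G + (B + V * \<delta>) * (((C + M * \<delta>)\<^sup>2 * s ^ 3 / 2 + M * s\<^sup>2) / N * G)
      + V * C * s\<^sup>2 / N * G"
    using t1 t2 t3 unfolding E_def by linarith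
  also have "\<dots> = (M' * (s ^ 1 * G) + ((B + V * \<delta>) * M + V * C) * (s ^ 2 * G)
      + (B + V * \<delta>) * (C + M * \<delta>)\<^sup>2 / 2 * (s ^ 3 * G)) / N"
    using N by (simp add: field_simps)
  also have "\<dots> \<le> (M' * (fact 1 * (8 / \<kappa>) ^ 1 * ?e) + ((B + V * \<delta>) * M + V * C) * (fact 2 * (8 / \<kappa>)\<^sup>2 * ?e)
      + (B + V * \<delta>) * (C + M * \<delta>)\<^sup>2 / 2 * (fact 3 * (8 / \<kappa>) ^ 3 * ?e)) / N"
    using N nonneg \<delta>0 by (intro divide_right_mono add_mono mult_left_mono p) auto
  also have "\<dots> = K / N * ?e"
    by (simp add: K_def fact_numeral algebra_simps add_divide_distrib)
  finally show "?lhs \<le> K / N * exp (- (\<kappa> / 8 * N * r\<^sup>2))"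
    by (simp add: s_def mult.assoc)
qed

text \<open>
  Integrating the pointwise bound: the subtracted correction is odd on the ball of radius \<open>\<delta>\<close> and so
  has integral zero.  Outside the ball, \<open>w\<close> is exponentially small, and the tail of the Gaussian
  carries a factor \<open>1 / N\<close> because \<open>exp (- x) \<le> 1 / x\<close>.
\<close>

lemma laplace_integral_bound:
  fixes H :: "real^'p^'p" and \<beta> w g T :: "real^'p \<Rightarrow> real" and v :: "real^'p"
  assumes pd: "pos_def H" and N: "0 < N" and \<kappa>: "0 < \<kappa>" and \<delta>0: "0 < \<delta>"
    and nonneg: "0 \<le> M" "0 \<le> C" "0 \<le> M'" "0 \<le> c"
    and ellip: "\<And>u. \<kappa> * (norm u)\<^sup>2 \<le> u \<bullet> (H *v u)"
    and T[measurable]: "T \<in> borel_measurable borel" and T_odd: "\<And>u. T (- u) = - T u"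
    and T_le: "\<And>u. \<bar>T u\<bar> \<le> C * norm u ^ 3" and \<delta>: "C * \<delta> + M * \<delta>\<^sup>2 \<le> \<kappa> / 4"
    and w[measurable]: "w \<in> borel_measurable borel" and w0: "\<And>u. 0 \<le> w u"
    and near: "\<And>u. norm u < \<delta> \<Longrightarrow> w u = exp (N * g u)"
    and g: "\<And>u. norm u < \<delta> \<Longrightarrow> \<bar>g u + u \<bullet> (H *v u) / 2 - T u\<bar> \<le> M * norm u ^ 4"
    and far: "\<And>u. \<delta> \<le> norm u \<Longrightarrow> w u \<le> exp (- (c * N))"
    and \<beta>: "integrable lborel \<beta>" "(LINT u|lborel. \<bar>\<beta> u\<bar>) \<le> B'"
    and \<beta>_exp: "\<And>u. norm u < \<delta> \<Longrightarrow> \<bar>\<beta> u - \<beta> 0 - v \<bullet> u\<bar> \<le> M' * (norm u)\<^sup>2"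
    and B: "\<bar>\<beta> 0\<bar> \<le> B" and V: "norm v \<le> V"
  defines "K \<equiv> M' * (8 / \<kappa>) + ((B + V * \<delta>) * M + V * C) * (2 * (8 / \<kappa>)\<^sup>2)
                 + (B + V * \<delta>) * (C + M * \<delta>)\<^sup>2 / 2 * (6 * (8 / \<kappa>) ^ 3)"
  shows "\<bar>(LINT u|lborel. \<beta> u * w u) - \<beta> 0 * (det H powr (- 1 / 2) * (2 * pi / N) powr (real CARD('p) / 2))\<bar>
    \<le> (K + B * (8 / (\<kappa> * \<delta>\<^sup>2))) / N * (8 * pi / (\<kappa> * N)) powr (real CARD('p) / 2) + exp (- (c * N)) * B'"
proof -
  have [measurable]: "\<beta> \<in> borel_measurable borel" using \<beta>(1) by auto
  have [measurable]: "(*v) H \<in> borel_measurable borel"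
    by (intro borel_measurable_continuous_onI matrix_vector_mult_linear_continuous_on)
  have BV: "0 \<le> B" "0 \<le> V" using B V norm_ge_zero[of v] by linarith+
  have K0: "0 \<le> K" unfolding K_def using nonneg BV \<kappa> \<delta>0 by (intro add_nonneg_nonneg mult_nonneg_nonneg) auto
  define E where "E = (\<lambda>u. exp (- (N * (u \<bullet> (H *v u)) / 2)))"
  \<comment> \<open>The first-order correction, cut off where the expansion is available.\<close>
  define odd_part where "odd_part = (\<lambda>u. indicator (ball 0 \<delta>) u * ((v \<bullet> u + \<beta> 0 * (N * T u)) * E u))"
  define D where "D = (\<lambda>u. \<beta> u * w u - \<beta> 0 * E u - odd_part u)"
  define G where "G = (\<lambda>u::real^'p. exp (- (\<kappa> / 8 * N * (norm u)\<^sup>2)))"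
  have [measurable]: "E \<in> borel_measurable borel"
    unfolding E_def by measurable
  have [measurable]: "ball (0 :: real^'p) \<delta> \<in> sets borel" by simp
  have [measurable]: "odd_part \<in> borel_measurable borel"
    unfolding odd_part_def by measurable
  have E_int: "has_bochner_integral lborel E (det H powr (- 1 / 2) * (2 * pi / N) powr (real CARD('p) / 2))"
    unfolding E_def by (rule gaussian_integral[OF pd N])
  have G_int: "has_bochner_integral lborel G ((8 * pi / (\<kappa> * N)) powr (real CARD('p) / 2))"
    using has_bochner_integral_gaussian_norm[of "\<kappa> / 8 * N", where 'n='p] \<kappa> N
    by (simp add: G_def field_simps)
  have bnd: "norm u < \<delta> \<Longrightarrow> \<bar>\<beta> u * exp (N * g u) - \<beta> 0 * exp (- (N * (u \<bullet> (H *v u)) / 2))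
        - (v \<bullet> u + \<beta> 0 * (N * T u)) * exp (- (N * (u \<bullet> (H *v u)) / 2))\<bar>
       \<le> K / N * exp (- (\<kappa> / 8 * N * (norm u)\<^sup>2))"
    and g_le: "norm u < \<delta> \<Longrightarrow> g u \<le> 0" for u
  proof -
    assume u: "norm u < \<delta>"
    have vu: "\<bar>v \<bullet> u\<bar> \<le> V * norm u"
      using Cauchy_Schwarz_ineq2[of v u] mult_right_mono[OF V, of "norm u"] by simp
    note * = laplace_integrand_bound[OF N \<kappa> norm_ge_zero less_imp_le[OF u] nonneg(1-3) BV(2,1) ellip g[OF u] T_le \<delta> \<beta>_exp[OF u] vu B]
    show "\<bar>\<beta> u * exp (N * g u) - \<beta> 0 * exp (- (N * (u \<bullet> (H *v u)) / 2))
        - (v \<bullet> u + \<beta> 0 * (N * T u)) * exp (- (N * (u \<bullet> (H *v u)) / 2))\<bar>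
       \<le> K / N * exp (- (\<kappa> / 8 * N * (norm u)\<^sup>2))"
      using *(1) unfolding K_def .
    show "g u \<le> 0" by (rule *(2))
  qed
  have w1: "w u \<le> 1" for u
  proof (cases "norm u < \<delta>")
    case True
    then show ?thesis using near g_le N by (simp add: mult_nonneg_nonpos)
  next
    case False
    then have "w u \<le> exp (- (c * N))" using far by simp
    also have "\<dots> \<le> 1" using nonneg N by simp
    finally show ?thesis .
  qed
  have \<beta>w_int: "integrable lborel (\<lambda>u. \<beta> u * w u)"
  proof (rule Bochner_Integration.integrable_bound[OF \<beta>(1)])
    show "AE u in lborel. norm (\<beta> u * w u) \<le> norm (\<beta> u)"
      using w0 w1 by (auto simp: abs_mult intro!: mult_left_le)
  qed measurable
  have D_le: "\<bar>D u\<bar> \<le> (K + B * (8 / (\<kappa> * \<delta>\<^sup>2))) / N * G u + exp (- (c * N)) * \<bar>\<beta> u\<bar>" for u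
  proof (cases "norm u < \<delta>")
    case True
    then have "\<bar>D u\<bar> \<le> K / N * G u"
      using bnd[OF True] by (simp add: D_def odd_part_def E_def G_def near)
    also have "\<dots> \<le> (K + B * (8 / (\<kappa> * \<delta>\<^sup>2))) / N * G u"
      using N BV \<kappa> by (intro mult_right_mono divide_right_mono) (auto simp: G_def)
    finally show ?thesis by (smt (verit) abs_ge_zero exp_ge_zero mult_nonneg_nonneg)
  next
    case False
    then have "odd_part u = 0" by (simp add: odd_part_def)
    then have "\<bar>D u\<bar> \<le> \<bar>\<beta> u\<bar> * w u + \<bar>\<beta> 0\<bar> * E u"
      using w0[of u] abs_triangle_ineq4[of "\<beta> u * w u" "\<beta> 0 * E u"]
      by (simp add: D_def E_def abs_mult)
    also have "\<bar>\<beta> u\<bar> * w u \<le> \<bar>\<beta> u\<bar> * exp (- (c * N))"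
      using False far by (intro mult_left_mono) auto
    also have "\<bar>\<beta> 0\<bar> * E u \<le> B * (8 / (\<kappa> * \<delta>\<^sup>2) / N * G u)"
    proof (intro mult_mono B)
      define s where "s = \<kappa> / 8 * N * (norm u)\<^sup>2"
      have s: "\<kappa> / 8 * N * \<delta>\<^sup>2 \<le> s"
        unfolding s_def using False N \<kappa> \<delta>0 by (intro mult_left_mono power_mono) auto
      have s0: "0 < \<kappa> / 8 * N * \<delta>\<^sup>2" using N \<kappa> \<delta>0 by simp
      have "\<kappa> * (norm u)\<^sup>2 \<le> 2 * (u \<bullet> (H *v u))"
        using ellip[of u] mult_nonneg_nonneg[of \<kappa> "(norm u)\<^sup>2"] \<kappa> zero_le_power2[of "norm u"] by linarith
      from mult_left_mono[OF this, of N] have "E u \<le> exp (- (s + s))"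
        using N by (simp add: E_def s_def algebra_simps)
      also have "\<dots> = exp (- s) * exp (- s)" by (simp add: exp_add[symmetric])
      also have "\<dots> \<le> exp (- s) * (1 / (\<kappa> / 8 * N * \<delta>\<^sup>2))"
      proof (rule mult_left_mono)
        have "exp (- s) \<le> 1 / s"
          using power_times_exp_minus_le[of s 1 1] s s0 by (simp add: field_simps)
        also have "\<dots> \<le> 1 / (\<kappa> / 8 * N * \<delta>\<^sup>2)" using s s0 by (intro divide_left_mono) auto
        finally show "exp (- s) \<le> 1 / (\<kappa> / 8 * N * \<delta>\<^sup>2)" .
      qed simp
      finally show "E u \<le> 8 / (\<kappa> * \<delta>\<^sup>2) / N * G u" by (simp add: G_def s_def field_simps)
    qed (use BV in \<open>auto simp: E_def\<close>)
    finally have "\<bar>D u\<bar> \<le> \<bar>\<beta> u\<bar> * exp (- (c * N)) + B * (8 / (\<kappa> * \<delta>\<^sup>2) / N * G u)" by simp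
    moreover have "0 \<le> K / N * G u" using K0 N by (simp add: G_def)
    ultimately show ?thesis by (simp add: add_divide_distrib algebra_simps)
  qed
  define R where "R = (\<lambda>u. (K + B * (8 / (\<kappa> * \<delta>\<^sup>2))) / N * G u + exp (- (c * N)) * \<bar>\<beta> u\<bar>)"
  have R_int: "integrable lborel R" unfolding R_def using G_int \<beta>(1) by (auto simp: has_bochner_integral_iff)
  have [measurable]: "D \<in> borel_measurable borel" unfolding D_def by measurable
  have D_int: "integrable lborel D"
    by (rule Bochner_Integration.integrable_bound[OF R_int]) (use D_le in \<open>auto simp: R_def intro: order_trans[OF _ abs_ge_self]\<close>)
  have odd_int: "integrable lborel odd_part"
  proof -
    have "odd_part = (\<lambda>u. \<beta> u * w u - \<beta> 0 * E u - D u)" by (simp add: D_def)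
    then show ?thesis using \<beta>w_int E_int D_int by (auto simp: has_bochner_integral_iff)
  qed
  have "(LINT u|lborel. odd_part u) = 0"
  proof (rule integral_lborel_odd_eq_0)
    have "H *v (- u) = - (H *v u)" for u
      by (simp add: linear_neg matrix_vector_mul_linear)
    then show "odd_part (- u) = - odd_part u" for u
      by (simp add: odd_part_def E_def T_odd indicator_def algebra_simps)
  qed measurable
  moreover have "(LINT u|lborel. D u) = (LINT u|lborel. \<beta> u * w u) - \<beta> 0 * (LINT u|lborel. E u) - (LINT u|lborel. odd_part u)"
    unfolding D_def using \<beta>w_int E_int odd_int by (simp add: has_bochner_integral_iff)
  ultimately have "(LINT u|lborel. \<beta> u * w u) - \<beta> 0 * (det H powr (- 1 / 2) * (2 * pi / N) powr (real CARD('p) / 2)) = (LINT u|lborel. D u)"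
    using E_int by (simp add: has_bochner_integral_iff)
  also have "\<bar>LINT u|lborel. D u\<bar> \<le> (LINT u|lborel. R u)"
    using D_int R_int D_le
    by (intro order_trans[OF integral_abs_bound] integral_mono) (auto simp: R_def)
  also have "\<dots> = (K + B * (8 / (\<kappa> * \<delta>\<^sup>2))) / N * (8 * pi / (\<kappa> * N)) powr (real CARD('p) / 2) + exp (- (c * N)) * (LINT u|lborel. \<bar>\<beta> u\<bar>)"
    unfolding R_def using G_int \<beta>(1) by (simp add: has_bochner_integral_iff)
  also have "\<dots> \<le> (K + B * (8 / (\<kappa> * \<delta>\<^sup>2))) / N * (8 * pi / (\<kappa> * N)) powr (real CARD('p) / 2) + exp (- (c * N)) * B'"
    using \<beta>(2) by simp
  finally show ?thesis by simp
qed

lemma average_le_of_integrable: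
  fixes \<beta> :: "'a::euclidean_space \<Rightarrow> real"
  assumes "integrable lborel \<beta>" "(LINT u|lborel. \<bar>\<beta> u\<bar>) \<le> B"
    and A: "A \<in> sets lborel" "emeasure lborel A < \<infinity>"
    and k: "\<And>u. u \<in> A \<Longrightarrow> k \<le> \<bar>\<beta> u\<bar> + \<bar>\<beta> (- u)\<bar>"
  shows "k * measure lborel A \<le> 2 * B"
proof -
  have [measurable]: "\<beta> \<in> borel_measurable borel" using assms(1) by auto
  have i1: "integrable lborel (\<lambda>u. \<bar>\<beta> u\<bar>)" using assms(1) by simp
  then have "integrable (distr lborel borel uminus) (\<lambda>u. \<bar>\<beta> u\<bar>)" by (simp add: lborel_distr_reflect)
  then have i2: "integrable lborel (\<lambda>u. \<bar>\<beta> (- u)\<bar>)"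
    by (subst (asm) integrable_distr_eq) auto
  have e2: "(LINT u|lborel. \<bar>\<beta> (- u)\<bar>) = (LINT u|lborel. \<bar>\<beta> u\<bar>)"
    by (subst (2) lborel_distr_reflect[symmetric]) (simp add: integral_distr)
  have "k * measure lborel A = (LINT u|lborel. k * indicator A u)" using A by simp
  also have "\<dots> \<le> (LINT u|lborel. \<bar>\<beta> u\<bar> + \<bar>\<beta> (- u)\<bar>)"
  proof (rule integral_mono)
    show "integrable lborel (\<lambda>u. k * indicator A u)"
      using A by (intro integrable_mult_right integrable_real_indicator)
    show "integrable lborel (\<lambda>u. \<bar>\<beta> u\<bar> + \<bar>\<beta> (- u)\<bar>)" using i1 i2 by simp
    show "k * indicator A u \<le> \<bar>\<beta> u\<bar> + \<bar>\<beta> (- u)\<bar>" for u using k[of u] by (simp add: indicator_def)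
  qed
  also have "\<dots> \<le> 2 * B" using i1 i2 e2 assms(2) by simp
  finally show ?thesis .
qed

text \<open>
  An integrable function that is affine up to a quadratic error on a ball has bounded coefficients.
  The even part \<open>\<beta> u + \<beta> (- u)\<close> isolates \<open>\<beta> 0\<close> and the odd part \<open>\<beta> u - \<beta> (- u)\<close> isolates \<open>v \<bullet> u\<close>; their
  averages are controlled by the integral of \<open>\<bar>\<beta>\<bar>\<close>.  For \<open>v\<close> the average is taken over a smaller
  ball, shifted in the direction of \<open>v\<close>, on which \<open>v \<bullet> u\<close> is at least \<open>norm v * \<delta> / 4\<close>.
\<close>

lemma expansion_coefficients_bounded:
  fixes \<beta> :: "'a::euclidean_space \<Rightarrow> real"
  assumes \<beta>: "integrable lborel \<beta>" "(LINT u|lborel. \<bar>\<beta> u\<bar>) \<le> B"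
    and \<delta>: "0 < \<delta>" and M: "0 \<le> M"
    and ex: "\<And>u. norm u < \<delta> \<Longrightarrow> \<bar>\<beta> u - \<beta> 0 - v \<bullet> u\<bar> \<le> M * (norm u)\<^sup>2"
  shows "\<bar>\<beta> 0\<bar> \<le> B / measure lborel (ball (0::'a) \<delta>) + M * \<delta>\<^sup>2"
    and "norm v \<le> 4 / \<delta> * (B / measure lborel (ball (0::'a) (\<delta> / 4)) + M * \<delta>\<^sup>2)"
proof -
  have fin: "emeasure lborel (ball x r) < \<infinity>" for x :: 'a and r
    using emeasure_bounded_finite bounded_ball by blast
  have vol: "measure lborel (ball x r) = measure lborel (ball (0::'a) r)" "0 < measure lborel (ball x r)"
    if "0 < r" for x :: 'a and r
    using that by (simp_all add: content_ball)
  have ex': "\<bar>\<beta> u - \<beta> 0 - v \<bullet> u\<bar> \<le> M * \<delta>\<^sup>2" "\<bar>\<beta> (- u) - \<beta> 0 + v \<bullet> u\<bar> \<le> M * \<delta>\<^sup>2" if "norm u < \<delta>" for u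
  proof -
    have "M * (norm u)\<^sup>2 \<le> M * \<delta>\<^sup>2" using that M \<delta> by (intro mult_left_mono power_mono) auto
    then show "\<bar>\<beta> u - \<beta> 0 - v \<bullet> u\<bar> \<le> M * \<delta>\<^sup>2" "\<bar>\<beta> (- u) - \<beta> 0 + v \<bullet> u\<bar> \<le> M * \<delta>\<^sup>2"
      using ex[of u] ex[of "- u"] that by simp_all
  qed
  have "(2 * \<bar>\<beta> 0\<bar> - 2 * (M * \<delta>\<^sup>2)) * measure lborel (ball (0::'a) \<delta>) \<le> 2 * B"
  proof (rule average_le_of_integrable[OF \<beta> _ fin])
    fix u :: 'a assume "u \<in> ball 0 \<delta>"
    then have "norm u < \<delta>" by simp
    from ex'[OF this] show "2 * \<bar>\<beta> 0\<bar> - 2 * (M * \<delta>\<^sup>2) \<le> \<bar>\<beta> u\<bar> + \<bar>\<beta> (- u)\<bar>" by linarith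
  qed simp
  then show "\<bar>\<beta> 0\<bar> \<le> B / measure lborel (ball (0::'a) \<delta>) + M * \<delta>\<^sup>2"
    using vol(2)[OF \<delta>, of 0] by (simp add: field_simps)
  show "norm v \<le> 4 / \<delta> * (B / measure lborel (ball (0::'a) (\<delta> / 4)) + M * \<delta>\<^sup>2)"
  proof (cases "v = 0")
    case True
    have "0 \<le> (LINT u|lborel. \<bar>\<beta> u\<bar>)" by simp
    then have "0 \<le> B" using \<beta>(2) by linarith
    then show ?thesis using True M \<delta> by simp
  next
    case False
    define e where "e = v /\<^sub>R norm v"
    have e: "norm e = 1" "v \<bullet> e = norm v"
      using False by (simp_all add: e_def power2_norm_eq_inner[symmetric] power2_eq_square)
    have "(2 * (norm v * \<delta> / 4) - 2 * (M * \<delta>\<^sup>2)) * measure lborel (ball ((\<delta> / 2) *\<^sub>R e) (\<delta> / 4)) \<le> 2 * B"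
    proof (rule average_le_of_integrable[OF \<beta> _ fin])
      fix u :: 'a assume "u \<in> ball ((\<delta> / 2) *\<^sub>R e) (\<delta> / 4)"
      then have d: "norm (u - (\<delta> / 2) *\<^sub>R e) < \<delta> / 4" by (simp add: dist_norm norm_minus_commute)
      have "norm u \<le> norm (u - (\<delta> / 2) *\<^sub>R e) + norm ((\<delta> / 2) *\<^sub>R e)"
        using norm_triangle_ineq[of "u - (\<delta> / 2) *\<^sub>R e" "(\<delta> / 2) *\<^sub>R e"] by simp
      then have u: "norm u < \<delta>" using d e \<delta> by simp
      have "v \<bullet> u = norm v * \<delta> / 2 + v \<bullet> (u - (\<delta> / 2) *\<^sub>R e)"
        using e by (simp add: inner_diff_right)
      moreover have "\<bar>v \<bullet> (u - (\<delta> / 2) *\<^sub>R e)\<bar> \<le> norm v * (\<delta> / 4)"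
        using Cauchy_Schwarz_ineq2[of v "u - (\<delta> / 2) *\<^sub>R e"] mult_left_mono[OF less_imp_le[OF d], of "norm v"] by simp
      ultimately have "norm v * \<delta> / 4 \<le> v \<bullet> u" by linarith
      with ex'[OF u] show "2 * (norm v * \<delta> / 4) - 2 * (M * \<delta>\<^sup>2) \<le> \<bar>\<beta> u\<bar> + \<bar>\<beta> (- u)\<bar>" by linarith
    qed simp
    moreover have "0 < measure lborel (ball (0::'a) (\<delta> / 4))" using vol(2)[of "\<delta> / 4" 0] \<delta> by simp
    ultimately have "norm v * \<delta> / 4 \<le> B / measure lborel (ball (0::'a) (\<delta> / 4)) + M * \<delta>\<^sup>2"
      using vol(1)[of "\<delta> / 4" "(\<delta> / 2) *\<^sub>R e"] \<delta> by (simp add: field_simps)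
    then show ?thesis using \<delta> by (simp add: field_simps)
  qed
qed

section \<open>Likelihood integrals and posterior means of a single sample\<close>

text \<open>
  The properties of one likelihood function \<open>L\<close>, for a sample of size \<open>m\<close> with maximum at \<open>t\<close>, that the
  Laplace expansion uses.  The exponent \<open>\<alpha>\<close> does not occur: in the variable \<open>u = h / sqrt (\<alpha> m)\<close> the
  remainder of the log-likelihood is \<open>\<alpha> m\<close> times the expression bounded here.
  The numbers \<open>\<kappa>\<close>, \<open>D\<close>, \<open>\<delta>\<close>, \<open>M\<close>, \<open>C\<close>, \<open>c\<close> are kept as parameters so that one error constant
  serves all likelihoods that share them.
\<close>

definition peaked_likelihood ::
  "(real^'p) set \<Rightarrow> (real^'p \<Rightarrow> real) \<Rightarrow> real^'p \<Rightarrow> real \<Rightarrow> real^'p^'p \<Rightarrow>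
   real \<Rightarrow> real \<Rightarrow> real \<Rightarrow> real \<Rightarrow> real \<Rightarrow> real \<Rightarrow> bool" where
  "peaked_likelihood \<Theta> L t m H \<kappa> D \<delta> M C c \<longleftrightarrow>
     set_borel_measurable borel \<Theta> L \<and> (\<forall>\<theta>\<in>\<Theta>. 0 \<le> L \<theta>) \<and>
     pos_def H \<and> det H \<le> D \<and> (\<forall>u. \<kappa> * (norm u)\<^sup>2 \<le> u \<bullet> (H *v u)) \<and>
     (\<exists>T. T \<in> borel_measurable borel \<and> (\<forall>u. T (- u) = - T u \<and> \<bar>T u\<bar> \<le> C * norm u ^ 3) \<and>
        (\<forall>u. norm u < \<delta> \<longrightarrow> t + u \<in> \<Theta> \<and> 0 < L (t + u) \<and>
           \<bar>(ln (L (t + u)) - ln (L t)) / m + u \<bullet> (H *v u) / 2 - T u\<bar> \<le> M * norm u ^ 4)) \<and>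
     (\<forall>\<theta>\<in>\<Theta>. \<delta> \<le> norm (\<theta> - t) \<longrightarrow> L \<theta> \<le> L t * exp (- (c * m)))"

text \<open>
  The gradient \<open>v\<close> may vary with the sample; its size is controlled by the integral of \<open>b\<close>.
\<close>

definition linear_up_to_quadratic :: "('a::real_inner \<Rightarrow> real) \<Rightarrow> 'a \<Rightarrow> real \<Rightarrow> real \<Rightarrow> bool" where
  "linear_up_to_quadratic b t \<delta> M \<longleftrightarrow>
     (\<exists>v. \<forall>u. norm u < \<delta> \<longrightarrow> \<bar>b (t + u) - b t - v \<bullet> u\<bar> \<le> M * (norm u)\<^sup>2)"

lemma integral_recentre:
  fixes b :: "real^'p \<Rightarrow> real" and t :: "real^'p"
  assumes "set_integrable lborel \<Theta> b"
  defines "\<beta> \<equiv> \<lambda>u. indicator \<Theta> (t + u) * b (t + u)"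
  shows "integrable lborel \<beta>" "(LINT u|lborel. \<bar>\<beta> u\<bar>) = (LINT \<theta>:\<Theta>|lborel. \<bar>b \<theta>\<bar>)"
proof -
  have i: "integrable lborel (\<lambda>\<theta>. indicator \<Theta> \<theta> * b \<theta>)"
    using assms by (simp add: set_integrable_def)
  show "integrable lborel \<beta>" unfolding \<beta>_def by (rule integrable_lborel_translate[OF i])
  have m: "(\<lambda>\<theta>. \<bar>indicator \<Theta> \<theta> * b \<theta>\<bar>) \<in> borel_measurable borel" using i by auto
  have "(LINT u|lborel. \<bar>\<beta> u\<bar>) = (LINT \<theta>|lborel. \<bar>indicator \<Theta> \<theta> * b \<theta>\<bar>)"
    unfolding \<beta>_def by (rule integral_lborel_translate[OF m])
  then show "(LINT u|lborel. \<bar>\<beta> u\<bar>) = (LINT \<theta>:\<Theta>|lborel. \<bar>b \<theta>\<bar>)"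
    by (simp add: set_lebesgue_integral_def abs_mult)
qed

lemma linear_up_to_quadratic_bounded:
  fixes b :: "real^'p \<Rightarrow> real"
  assumes "set_integrable lborel \<Theta> b" "(LINT \<theta>:\<Theta>|lborel. \<bar>b \<theta>\<bar>) \<le> B"
    and \<delta>: "0 < \<delta>" and M: "0 \<le> M"
    and \<Theta>: "\<And>u. norm u < \<delta> \<Longrightarrow> t + u \<in> \<Theta>"
    and v: "\<And>u. norm u < \<delta> \<Longrightarrow> \<bar>b (t + u) - b t - v \<bullet> u\<bar> \<le> M * (norm u)\<^sup>2"
  shows "\<bar>b t\<bar> \<le> B / measure lborel (ball (0::real^'p) \<delta>) + M * \<delta>\<^sup>2"
    and "norm v \<le> 4 / \<delta> * (B / measure lborel (ball (0::real^'p) (\<delta> / 4)) + M * \<delta>\<^sup>2)"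
proof -
  define \<beta> where "\<beta> = (\<lambda>u. indicator \<Theta> (t + u) * b (t + u))"
  have \<beta>: "integrable lborel \<beta>" "(LINT u|lborel. \<bar>\<beta> u\<bar>) \<le> B"
    using integral_recentre[OF assms(1), where t = t] assms(2) by (simp_all add: \<beta>_def)
  have t: "t \<in> \<Theta>" using \<Theta>[of 0] \<delta> by simp
  have "\<bar>\<beta> u - \<beta> 0 - v \<bullet> u\<bar> \<le> M * (norm u)\<^sup>2" if "norm u < \<delta>" for u
    using v[OF that] \<Theta>[OF that] t by (simp add: \<beta>_def)
  from expansion_coefficients_bounded[OF \<beta> \<delta> M this]
  show "\<bar>b t\<bar> \<le> B / measure lborel (ball (0::real^'p) \<delta>) + M * \<delta>\<^sup>2"
    and "norm v \<le> 4 / \<delta> * (B / measure lborel (ball (0::real^'p) (\<delta> / 4)) + M * \<delta>\<^sup>2)"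
    using t by (simp_all add: \<beta>_def)
qed

text \<open>
  One constant works for all centres, matrices, exponents and integrands that share the numerical
  bounds; this uniformity is what turns into a statement in probability later.  The normalising
  factor is at least of order \<open>N\<^sup>-\<^sup>p\<^sup>/\<^sup>2\<close>, since \<open>det H\<close> is bounded above, so the term \<open>exp (- c N)\<close>
  stays of order \<open>1 / N\<close> after division.
\<close>

lemma laplace_expansion:
  fixes \<kappa> \<delta> M C c D M' B :: real
  assumes pos: "0 < \<kappa>" "0 < \<delta>" "0 < c" and nonneg: "0 \<le> M" "0 \<le> C" "0 \<le> M'" "0 \<le> D" "0 \<le> B"
    and \<delta>: "C * \<delta> + M * \<delta>\<^sup>2 \<le> \<kappa> / 4"
  shows "\<exists>K\<ge>0. \<forall>\<Theta> L (t :: real^'p) m H a b.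
    peaked_likelihood \<Theta> L t m H \<kappa> D \<delta> M C c \<longrightarrow>
    set_integrable lborel \<Theta> b \<longrightarrow> (LINT \<theta>:\<Theta>|lborel. \<bar>b \<theta>\<bar>) \<le> B \<longrightarrow>
    linear_up_to_quadratic b t \<delta> M' \<longrightarrow> 0 < m \<longrightarrow> 0 < a \<longrightarrow> 1 \<le> a * m \<longrightarrow>
    \<bar>(LINT \<theta>:\<Theta>|lborel. b \<theta> * L \<theta> powr a)
       / (L t powr a * det H powr (- 1 / 2) * (2 * pi / (a * m)) powr (real CARD('p) / 2)) - b t\<bar>
     \<le> K / (a * m)"
proof -
  define p where "p = real CARD('p) / 2"
  define B0 where "B0 = B / measure lborel (ball (0::real^'p) \<delta>) + M' * \<delta>\<^sup>2"
  define V where "V = 4 / \<delta> * (B / measure lborel (ball (0::real^'p) (\<delta> / 4)) + M' * \<delta>\<^sup>2)"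
  define K1 where "K1 = M' * (8 / \<kappa>) + ((B0 + V * \<delta>) * M + V * C) * (2 * (8 / \<kappa>)\<^sup>2)
                 + (B0 + V * \<delta>) * (C + M * \<delta>)\<^sup>2 / 2 * (6 * (8 / \<kappa>) ^ 3)"
  define K2 where "K2 = K1 + B0 * (8 / (\<kappa> * \<delta>\<^sup>2))"
  define F where "F = fact (CARD('p) + 1) / c ^ (CARD('p) + 1)"
  define K where "K = sqrt D * (K2 * (4 / \<kappa>) powr p + F * B)"
  have BV: "0 \<le> B0" "0 \<le> V" using pos nonneg by (simp_all add: B0_def V_def)
  have K1: "0 \<le> K1" unfolding K1_def using pos nonneg BV by (intro add_nonneg_nonneg mult_nonneg_nonneg) auto
  then have K2: "0 \<le> K2" unfolding K2_def using pos BV by simp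
  have F0: "0 \<le> F" using pos by (simp add: F_def)
  have K0: "0 \<le> K" unfolding K_def using K2 F0 nonneg by simp
  have "\<bar>(LINT \<theta>:\<Theta>|lborel. b \<theta> * L \<theta> powr a)
       / (L t powr a * det H powr (- 1 / 2) * (2 * pi / (a * m)) powr (real CARD('p) / 2)) - b t\<bar>
     \<le> K / (a * m)"
    if peak: "peaked_likelihood \<Theta> L t m H \<kappa> D \<delta> M C c"
      and b: "set_integrable lborel \<Theta> b" "(LINT \<theta>:\<Theta>|lborel. \<bar>b \<theta>\<bar>) \<le> B"
      and lin: "linear_up_to_quadratic b t \<delta> M'" and m: "0 < m" and a: "0 < a" and N1: "1 \<le> a * m"
    for \<Theta> L and t :: "real^'p" and m H a b
  proof -
    define N where "N = a * m"
    have N: "0 < N" "1 \<le> N" using N1 by (simp_all add: N_def)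
    from peak have L_meas: "set_borel_measurable borel \<Theta> L" and L0: "\<And>\<theta>. \<theta> \<in> \<Theta> \<Longrightarrow> 0 \<le> L \<theta>"
      and pd: "pos_def H" and D: "det H \<le> D" and ellip: "\<And>u. \<kappa> * (norm u)\<^sup>2 \<le> u \<bullet> (H *v u)"
      and far: "\<And>\<theta>. \<theta> \<in> \<Theta> \<Longrightarrow> \<delta> \<le> norm (\<theta> - t) \<Longrightarrow> L \<theta> \<le> L t * exp (- (c * m))"
      by (auto simp: peaked_likelihood_def)
    from peak obtain T where T: "T \<in> borel_measurable borel" "\<And>u. T (- u) = - T u" "\<And>u. \<bar>T u\<bar> \<le> C * norm u ^ 3"
      and near: "\<And>u. norm u < \<delta> \<Longrightarrow> t + u \<in> \<Theta>" "\<And>u. norm u < \<delta> \<Longrightarrow> 0 < L (t + u)"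
        "\<And>u. norm u < \<delta> \<Longrightarrow> \<bar>(ln (L (t + u)) - ln (L t)) / m + u \<bullet> (H *v u) / 2 - T u\<bar> \<le> M * norm u ^ 4"
      unfolding peaked_likelihood_def by blast
    from lin obtain v where v: "\<And>u. norm u < \<delta> \<Longrightarrow> \<bar>b (t + u) - b t - v \<bullet> u\<bar> \<le> M' * (norm u)\<^sup>2"
      by (auto simp: linear_up_to_quadratic_def)
    have t: "t \<in> \<Theta>" and Lt: "0 < L t" using near(1,2)[of 0] pos by auto
    have bt: "\<bar>b t\<bar> \<le> B0" and vV: "norm v \<le> V"
      using linear_up_to_quadratic_bounded[OF b pos(2) nonneg(3) near(1) v] by (simp_all add: B0_def V_def)
    define \<beta> where "\<beta> = (\<lambda>u. indicator \<Theta> (t + u) * b (t + u))"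
    define w where "w = (\<lambda>u. (indicator \<Theta> (t + u) * L (t + u) / L t) powr a)"
    have \<beta>: "integrable lborel \<beta>" "(LINT u|lborel. \<bar>\<beta> u\<bar>) \<le> B"
      using integral_recentre[OF b(1), where t = t] b(2) by (simp_all add: \<beta>_def)
    have \<beta>t: "\<beta> 0 = b t" using t by (simp add: \<beta>_def)
    have Lm[measurable]: "(\<lambda>\<theta>. indicator \<Theta> \<theta> * L \<theta>) \<in> borel_measurable borel"
      using L_meas by (simp add: set_borel_measurable_def)
    have bm[measurable]: "(\<lambda>\<theta>. indicator \<Theta> \<theta> * b \<theta>) \<in> borel_measurable borel"
      using b(1) by (auto simp: set_integrable_def)
    have w_meas: "w \<in> borel_measurable borel"
    proof -
      have "(\<lambda>\<theta>. (indicator \<Theta> \<theta> * L \<theta> / L t) powr a) \<in> borel_measurable borel" by measurable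
      then show ?thesis unfolding w_def by measurable
    qed
    have w_near: "w u = exp (N * ((ln (L (t + u)) - ln (L t)) / m))" if "norm u < \<delta>" for u
      using near(1,2)[OF that] Lt m by (simp add: w_def powr_def ln_div N_def)
    have w_far: "w u \<le> exp (- (c * N))" if "\<delta> \<le> norm u" for u
    proof (cases "t + u \<in> \<Theta>")
      case True
      then have "L (t + u) / L t \<le> exp (- (c * m))"
        using far[OF True] that Lt by (simp add: field_simps)
      then have "w u \<le> exp (- (c * m)) powr a"
        using L0[OF True] Lt a True by (auto simp: w_def intro!: powr_mono2)
      then show ?thesis by (simp add: powr_def N_def algebra_simps)
    qed (simp add: w_def)
    have \<beta>v: "\<bar>\<beta> u - \<beta> 0 - v \<bullet> u\<bar> \<le> M' * (norm u)\<^sup>2" if "norm u < \<delta>" for u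
      using v[OF that] near(1)[OF that] t by (simp add: \<beta>_def)
    have w0: "0 \<le> w u" for u by (simp add: w_def)
    have "(LINT u|lborel. \<beta> u * w u)
        = (LINT \<theta>|lborel. (indicator \<Theta> \<theta> * b \<theta>) * (indicator \<Theta> \<theta> * L \<theta> / L t) powr a)"
      unfolding \<beta>_def w_def by (rule integral_lborel_translate) measurable
    also have "\<dots> = (LINT \<theta>|lborel. (indicator \<Theta> \<theta> *\<^sub>R (b \<theta> * L \<theta> powr a)) / L t powr a)"
      using Lt L0 by (intro Bochner_Integration.integral_cong refl) (auto simp: indicator_def powr_divide)
    also have "\<dots> = (LINT \<theta>:\<Theta>|lborel. b \<theta> * L \<theta> powr a) / L t powr a"
      by (simp add: set_lebesgue_integral_def)
    finally have I: "(LINT \<theta>:\<Theta>|lborel. b \<theta> * L \<theta> powr a) / L t powr a = (LINT u|lborel. \<beta> u * w u)" ..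
    define Z where "Z = det H powr (- 1 / 2) * (2 * pi / N) powr p"
    have d: "0 < det H" by (rule det_pos_def[OF pd])
    have Z: "0 < Z" using d N by (simp add: Z_def)
    have main: "\<bar>(LINT u|lborel. \<beta> u * w u) - b t * Z\<bar> \<le> K2 / N * (8 * pi / (\<kappa> * N)) powr p + exp (- (c * N)) * B"
      using laplace_integral_bound[OF pd N(1) pos(1,2) nonneg(1-3) less_imp_le[OF pos(3)] ellip T \<delta> w_meas w0
          w_near near(3) w_far \<beta> \<beta>v _ vV, of B0] bt
      by (simp add: \<beta>t K2_def K1_def Z_def p_def)
    have "1 / Z \<le> sqrt D * (N / (2 * pi)) powr p"
    proof -
      have "1 / Z = sqrt (det H) * (N / (2 * pi)) powr p"
        using d N by (simp add: Z_def powr_minus powr_half_sqrt powr_divide field_simps)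
      also have "\<dots> \<le> sqrt D * (N / (2 * pi)) powr p" using D by (intro mult_right_mono) auto
      finally show ?thesis .
    qed
    then have "\<bar>(LINT u|lborel. \<beta> u * w u) - b t * Z\<bar> * (1 / Z)
      \<le> (K2 / N * (8 * pi / (\<kappa> * N)) powr p + exp (- (c * N)) * B) * (sqrt D * (N / (2 * pi)) powr p)"
      using main Z by (intro mult_mono) auto
    also have "\<dots> = sqrt D * (K2 / N * ((8 * pi / (\<kappa> * N)) powr p * (N / (2 * pi)) powr p)
        + B * (exp (- (c * N)) * (N / (2 * pi)) powr p))"
      by (simp add: algebra_simps)
    also have "\<dots> \<le> sqrt D * (K2 / N * (4 / \<kappa>) powr p + B * (F / N))"
    proof (intro mult_left_mono add_mono)
      have "(8 * pi / (\<kappa> * N)) powr p * (N / (2 * pi)) powr p = (8 * pi / (\<kappa> * N) * (N / (2 * pi))) powr p"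
        by (rule powr_mult[symmetric])
      also have "8 * pi / (\<kappa> * N) * (N / (2 * pi)) = 4 / \<kappa>"
        using N by simp
      finally show "(8 * pi / (\<kappa> * N)) powr p * (N / (2 * pi)) powr p \<le> (4 / \<kappa>) powr p" by simp
      have "(N / (2 * pi)) powr p \<le> N powr p"
        using N pi_gt3 by (intro powr_mono2) (auto simp: p_def field_simps)
      also have "\<dots> \<le> N powr real CARD('p)"
        using N by (intro powr_mono) (auto simp: p_def)
      also have "\<dots> = N ^ (CARD('p) + 1) / N" using N by (simp add: powr_realpow)
      finally have "exp (- (c * N)) * (N / (2 * pi)) powr p \<le> exp (- (c * N)) * (N ^ (CARD('p) + 1) / N)"
        by (rule mult_left_mono) simp
      also have "\<dots> = (N ^ (CARD('p) + 1) * exp (- (c * N))) / N" by simp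
      also have "\<dots> \<le> F / N"
        unfolding F_def using power_times_exp_minus_le[of N c "CARD('p) + 1"] N pos
        by (intro divide_right_mono) auto
      finally show "exp (- (c * N)) * (N / (2 * pi)) powr p \<le> F / N" .
    qed (use K2 N nonneg in auto)
    also have "\<dots> = K / N" by (simp add: K_def add_divide_distrib algebra_simps)
    finally have "\<bar>((LINT u|lborel. \<beta> u * w u) - b t * Z) / Z\<bar> \<le> K / N"
      using Z by (simp add: abs_divide)
    also have "((LINT u|lborel. \<beta> u * w u) - b t * Z) / Z
       = (LINT \<theta>:\<Theta>|lborel. b \<theta> * L \<theta> powr a) / (L t powr a * det H powr (- 1 / 2) * (2 * pi / (a * m)) powr (real CARD('p) / 2)) - b t"
    proof -
      have "((LINT u|lborel. \<beta> u * w u) - b t * Z) / Z = (LINT u|lborel. \<beta> u * w u) / Z - b t"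
        using Z by (simp add: diff_divide_distrib)
      then show ?thesis by (simp only: I[symmetric] Z_def N_def p_def divide_divide_eq_left mult.assoc)
    qed
    finally show ?thesis by (simp add: N_def)
  qed
  then show ?thesis using K0 by blast
qed

text \<open>
  The posterior mean is the quotient of two Laplace integrals with the same normalising factor.
  Once normalised, the denominator is close to \<open>\<pi> t \<ge> \<pi>0\<close>, so it stays above \<open>\<pi>0 / 2\<close> once \<open>a m\<close> is large, and
  \<open>\<bar>q t\<bar>\<close> is bounded because \<open>\<bar>q t * \<pi> t\<bar>\<close> is.
\<close>

lemma posterior_mean_expansion:
  fixes \<kappa> \<delta> M C c D M' B \<pi>0 :: real
  assumes pos: "0 < \<kappa>" "0 < \<delta>" "0 < c" "0 < \<pi>0"
    and nonneg: "0 \<le> M" "0 \<le> C" "0 \<le> M'" "0 \<le> D" "0 \<le> B"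
    and \<delta>: "C * \<delta> + M * \<delta>\<^sup>2 \<le> \<kappa> / 4"
  shows "\<exists>K\<ge>0. \<exists>N0\<ge>1. \<forall>\<Theta> L (t :: real^'p) m H a \<pi> q.
    peaked_likelihood \<Theta> L t m H \<kappa> D \<delta> M C c \<longrightarrow>
    set_integrable lborel \<Theta> \<pi> \<longrightarrow> (LINT \<theta>:\<Theta>|lborel. \<bar>\<pi> \<theta>\<bar>) \<le> B \<longrightarrow>
    linear_up_to_quadratic \<pi> t \<delta> M' \<longrightarrow> \<pi>0 \<le> \<pi> t \<longrightarrow>
    set_integrable lborel \<Theta> (\<lambda>\<theta>. q \<theta> * \<pi> \<theta>) \<longrightarrow> (LINT \<theta>:\<Theta>|lborel. \<bar>q \<theta> * \<pi> \<theta>\<bar>) \<le> B \<longrightarrow>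
    linear_up_to_quadratic (\<lambda>\<theta>. q \<theta> * \<pi> \<theta>) t \<delta> M' \<longrightarrow>
    0 < m \<longrightarrow> 0 < a \<longrightarrow> N0 \<le> a * m \<longrightarrow>
    \<bar>posterior_mean \<Theta> \<pi> L a q - q t\<bar> \<le> K / (a * m)"
proof -
  obtain K1 where K1: "0 \<le> K1" and exp1: "\<And>\<Theta> L (t :: real^'p) m H a b.
    peaked_likelihood \<Theta> L t m H \<kappa> D \<delta> M C c \<Longrightarrow>
    set_integrable lborel \<Theta> b \<Longrightarrow> (LINT \<theta>:\<Theta>|lborel. \<bar>b \<theta>\<bar>) \<le> B \<Longrightarrow>
    linear_up_to_quadratic b t \<delta> M' \<Longrightarrow> 0 < m \<Longrightarrow> 0 < a \<Longrightarrow> 1 \<le> a * m \<Longrightarrow>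
    \<bar>(LINT \<theta>:\<Theta>|lborel. b \<theta> * L \<theta> powr a)
       / (L t powr a * det H powr (- 1 / 2) * (2 * pi / (a * m)) powr (real CARD('p) / 2)) - b t\<bar>
     \<le> K1 / (a * m)"
    using laplace_expansion[OF pos(1-3) nonneg \<delta>, where 'p='p] by blast
  define B0 where "B0 = B / measure lborel (ball (0::real^'p) \<delta>) + M' * \<delta>\<^sup>2"
  define K where "K = (K1 + B0 / \<pi>0 * K1) / (\<pi>0 / 2)"
  define N0 where "N0 = max 1 (2 * K1 / \<pi>0)"
  \<comment> \<open>\<open>B0\<close> bounds \<open>\<bar>q t * \<pi> t\<bar>\<close>, and \<open>N0\<close> makes the error of the denominator at most \<open>\<pi>0 / 2\<close>.\<close>
  have B0: "0 \<le> B0" using pos nonneg by (simp add: B0_def)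
  have K0: "0 \<le> K" using K1 B0 pos by (simp add: K_def)
  have "\<bar>posterior_mean \<Theta> \<pi> L a q - q t\<bar> \<le> K / (a * m)"
    if peak: "peaked_likelihood \<Theta> L t m H \<kappa> D \<delta> M C c"
      and \<pi>: "set_integrable lborel \<Theta> \<pi>" "(LINT \<theta>:\<Theta>|lborel. \<bar>\<pi> \<theta>\<bar>) \<le> B" "linear_up_to_quadratic \<pi> t \<delta> M'"
      and \<pi>t: "\<pi>0 \<le> \<pi> t"
      and b: "set_integrable lborel \<Theta> (\<lambda>\<theta>. q \<theta> * \<pi> \<theta>)" "(LINT \<theta>:\<Theta>|lborel. \<bar>q \<theta> * \<pi> \<theta>\<bar>) \<le> B"
        "linear_up_to_quadratic (\<lambda>\<theta>. q \<theta> * \<pi> \<theta>) t \<delta> M'"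
      and m: "0 < m" and a: "0 < a" and N0: "N0 \<le> a * m"
    for \<Theta> L and t :: "real^'p" and m H a \<pi> q
  proof -
    have N: "1 \<le> a * m" "2 * K1 / \<pi>0 \<le> a * m" using N0 by (simp_all add: N0_def)
    define Z where "Z = L t powr a * det H powr (- 1 / 2) * (2 * pi / (a * m)) powr (real CARD('p) / 2)"
    define I where "I = (LINT \<theta>:\<Theta>|lborel. q \<theta> * \<pi> \<theta> * L \<theta> powr a)"
    define J where "J = (LINT \<theta>:\<Theta>|lborel. \<pi> \<theta> * L \<theta> powr a)"
    from peak have near: "t + u \<in> \<Theta>" "0 < L (t + u)" if "norm u < \<delta>" for u
      using that unfolding peaked_likelihood_def by blast+
    have "0 < L t" using near(2)[of 0] pos by simp
    moreover have "0 < det H" using peak by (intro det_pos_def) (simp add: peaked_likelihood_def)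
    ultimately have Z: "0 < Z" using N m a by (simp add: Z_def)
    have I: "\<bar>I / Z - q t * \<pi> t\<bar> \<le> K1 / (a * m)"
      using exp1[OF peak b m a N(1)] by (simp add: I_def Z_def)
    have J: "\<bar>J / Z - \<pi> t\<bar> \<le> K1 / (a * m)"
      using exp1[OF peak \<pi> m a N(1)] by (simp add: J_def Z_def)
    obtain v where v: "\<And>u. norm u < \<delta> \<Longrightarrow> \<bar>q (t + u) * \<pi> (t + u) - q t * \<pi> t - v \<bullet> u\<bar> \<le> M' * (norm u)\<^sup>2"
      using b(3) by (auto simp: linear_up_to_quadratic_def)
    have bt: "\<bar>q t * \<pi> t\<bar> \<le> B0"
      using linear_up_to_quadratic_bounded(1)[OF b(1,2) pos(2) nonneg(3) near(1) v] by (simp add: B0_def)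
    have qt: "\<bar>q t\<bar> \<le> B0 / \<pi>0"
    proof -
      have "\<bar>q t\<bar> * \<pi>0 \<le> \<bar>q t\<bar> * \<pi> t" using \<pi>t by (intro mult_left_mono) auto
      also have "\<dots> \<le> B0" using bt pos \<pi>t by (simp add: abs_mult)
      finally show ?thesis using pos by (simp add: field_simps)
    qed
    have "K1 / (a * m) \<le> \<pi>0 / 2" using N pos by (simp add: field_simps)
    then have J2: "\<pi>0 / 2 \<le> J / Z" using J \<pi>t by linarith
    then have Jpos: "0 < J / Z" using pos by linarith
    have pm: "posterior_mean \<Theta> \<pi> L a q = (I / Z) / (J / Z)"
    proof -
      have "evidence \<Theta> \<pi> L a = J" unfolding evidence_def J_def by (simp add: mult.commute)
      moreover have "q \<theta> * (L \<theta> powr a * \<pi> \<theta> / J) = q \<theta> * \<pi> \<theta> * L \<theta> powr a / J" for \<theta> by simp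
      ultimately have "posterior_mean \<Theta> \<pi> L a q = (LINT \<theta>:\<Theta>|lborel. q \<theta> * \<pi> \<theta> * L \<theta> powr a / J)"
        by (simp only: posterior_mean_def alpha_posterior_def)
      also have "\<dots> = I / J" unfolding I_def by simp
      finally show ?thesis using Z by simp
    qed
    have "posterior_mean \<Theta> \<pi> L a q - q t = ((I / Z - q t * \<pi> t) - q t * (J / Z - \<pi> t)) / (J / Z)"
    proof -
      have "x / y - k = ((x - k * p) - k * (y - p)) / y" if "0 < y" for x y k p :: real
        using that by (simp add: field_simps)
      from this[OF Jpos] show ?thesis by (simp only: pm)
    qed
    also have "\<bar>\<dots>\<bar> = \<bar>(I / Z - q t * \<pi> t) - q t * (J / Z - \<pi> t)\<bar> / (J / Z)"
    proof -
      have "\<bar>x / y\<bar> = \<bar>x\<bar> / y" if "0 < y" for x y :: real using that by simp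
      from this[OF Jpos] show ?thesis .
    qed
    also have "\<dots> \<le> (K1 / (a * m) + B0 / \<pi>0 * (K1 / (a * m))) / (\<pi>0 / 2)"
    proof (rule frac_le)
      have "\<bar>q t * (J / Z - \<pi> t)\<bar> \<le> B0 / \<pi>0 * (K1 / (a * m))"
        unfolding abs_mult using qt J B0 pos by (intro mult_mono) auto
      then show "\<bar>(I / Z - q t * \<pi> t) - q t * (J / Z - \<pi> t)\<bar> \<le> K1 / (a * m) + B0 / \<pi>0 * (K1 / (a * m))"
        using I by linarith
      show "0 \<le> K1 / (a * m) + B0 / \<pi>0 * (K1 / (a * m))" using K1 B0 pos m a by simp
    qed (use pos J2 in auto)
    also have "\<dots> = K / (a * m)"
    proof -
      have "(k / x + k' * (k / x)) / d = (k + k' * k) / d / x" for k k' x d :: real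
        by (simp add: add_divide_distrib mult.commute)
      then show ?thesis unfolding K_def .
    qed
    finally show ?thesis .
  qed
  moreover have "1 \<le> N0" by (simp add: N0_def)
  ultimately show ?thesis using K0 by blast
qed

section \<open>Deterministic consequences of the assumptions\<close>

lemma linear_up_to_quadratic_mono:
  assumes "linear_up_to_quadratic b t \<delta> M" "\<delta>' \<le> \<delta>" "M \<le> M'"
  shows "linear_up_to_quadratic b t \<delta>' M'"
proof -
  obtain v where v: "\<And>u. norm u < \<delta> \<Longrightarrow> \<bar>b (t + u) - b t - v \<bullet> u\<bar> \<le> M * (norm u)\<^sup>2"
    using assms(1) by (auto simp: linear_up_to_quadratic_def)
  have "\<bar>b (t + u) - b t - v \<bullet> u\<bar> \<le> M' * (norm u)\<^sup>2" if "norm u < \<delta>'" for u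
  proof -
    have "M * (norm u)\<^sup>2 \<le> M' * (norm u)\<^sup>2" using assms(3) by (rule mult_right_mono) simp
    then show ?thesis using v[of u] that assms(2) by linarith
  qed
  then show ?thesis unfolding linear_up_to_quadratic_def by blast
qed

text \<open>
  The quadratic form is continuous on the product of \<open>K\<close> with the unit sphere, which is compact.
\<close>

lemma compact_pos_def_bounds:
  fixes K :: "(real^'p^'p) set"
  assumes "compact K" "K \<subseteq> {A. pos_def A}"
  obtains \<kappa> \<Lambda> D where "0 < \<kappa>" "0 \<le> \<Lambda>" "0 \<le> D"
    "\<And>A u. A \<in> K \<Longrightarrow> \<kappa> * (norm u)\<^sup>2 \<le> u \<bullet> (A *v u)"
    "\<And>A u. A \<in> K \<Longrightarrow> u \<bullet> (A *v u) \<le> \<Lambda> * (norm u)\<^sup>2"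
    "\<And>A. A \<in> K \<Longrightarrow> det A \<le> D"
proof (cases "K = {}")
  case True
  then show ?thesis using that[of 1 0 0] by simp
next
  case False
  define q where "q = (\<lambda>z :: (real^'p^'p) \<times> (real^'p). snd z \<bullet> (fst z *v snd z))"
  let ?S = "K \<times> sphere (0 :: real^'p) 1"
  have cS: "compact ?S" using assms(1) by (intro compact_Times compact_sphere)
  have "axis undefined 1 \<in> sphere (0 :: real^'p) 1" by simp
  then have nS: "?S \<noteq> {}" using False by blast
  have cq: "continuous_on ?S q"
    unfolding q_def inner_vec_def matrix_vector_mult_def
    by (simp add: continuous_on_sum continuous_on_mult continuous_on_component continuous_on_fst continuous_on_snd)
  obtain z1 where z1: "z1 \<in> ?S" "\<And>z. z \<in> ?S \<Longrightarrow> q z1 \<le> q z"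
    using continuous_attains_inf[OF cS nS cq] by blast
  obtain z2 where z2: "z2 \<in> ?S" "\<And>z. z \<in> ?S \<Longrightarrow> q z \<le> q z2"
    using continuous_attains_sup[OF cS nS cq] by blast
  have cdet: "continuous_on K det"
    unfolding det_def by (intro continuous_intros)
  obtain A3 where A3: "A3 \<in> K" "\<And>A. A \<in> K \<Longrightarrow> det A \<le> det A3"
    using continuous_attains_sup[OF assms(1) False cdet] by blast
  have qpos: "0 < q z" if "z \<in> ?S" for z
  proof -
    obtain A u where z: "z = (A, u)" by (cases z)
    then have "A \<in> K" "norm u = 1" using that by simp_all
    then have "pos_def A" "u \<noteq> 0" using assms(2) by auto
    then show ?thesis by (simp add: q_def z pos_def_def)
  qed
  have scale: "u \<bullet> (A *v u) = q (A, u /\<^sub>R norm u) * (norm u)\<^sup>2" if "u \<noteq> 0" for A and u :: "real^'p"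
    using that by (simp add: q_def matrix_vector_mult_scaleR power2_eq_square field_simps)
  have mem: "(A, u /\<^sub>R norm u) \<in> ?S" if "A \<in> K" "u \<noteq> 0" for A and u :: "real^'p"
    using that by simp
  show ?thesis
  proof (rule that[of "q z1" "q z2" "det A3"])
    fix A and u :: "real^'p" assume A: "A \<in> K"
    show "q z1 * (norm u)\<^sup>2 \<le> u \<bullet> (A *v u)"
    proof (cases "u = 0")
      case False
      then show ?thesis unfolding scale[OF False] using z1(2)[OF mem[OF A False]] by (intro mult_right_mono) auto
    qed simp
    show "u \<bullet> (A *v u) \<le> q z2 * (norm u)\<^sup>2"
    proof (cases "u = 0")
      case False
      then show ?thesis unfolding scale[OF False] using z2(2)[OF mem[OF A False]] by (intro mult_right_mono) auto
    qed simp
  qed (use qpos[OF z1(1)] qpos[OF z2(1)] A3 assms(2) det_pos_def[of A3] in auto)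
qed

text \<open>
  Taylor's theorem, uniformly in the centre \<open>t\<close>.  The mean value inequality is applied twice, to the
  gradient \<open>D\<close> and then to \<open>g y - D t \<bullet> y\<close>, whose gradient is \<open>D y - D t\<close>.
\<close>

lemma C2_linear_up_to_quadratic:
  fixes g :: "real^'p \<Rightarrow> real"
  assumes r: "0 < r" and C2: "C2_on (ball x r) g" and pos: "\<And>y. y \<in> ball x r \<Longrightarrow> 0 < g y"
  obtains \<delta> M g0 where "0 < \<delta>" "0 \<le> M" "0 < g0"
    "\<And>t. dist t x < \<delta> \<Longrightarrow> g0 \<le> g t \<and> linear_up_to_quadratic g t \<delta> M"
proof -
  obtain D D2 where D: "\<And>y. y \<in> ball x r \<Longrightarrow> (g has_derivative (\<lambda>h. D y \<bullet> h)) (at y)"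
    and D2: "\<And>y. y \<in> ball x r \<Longrightarrow> (D has_derivative (\<lambda>h. D2 y *v h)) (at y)"
    and cD2: "continuous_on (ball x r) D2"
    using C2 unfolding C2_on_def by blast
  define C where "C = cball x (r / 2)"
  have Cb: "C \<subseteq> ball x r" using r by (auto simp: C_def)
  have cC: "compact C" "C \<noteq> {}" using r by (auto simp: C_def)
  have "continuous_on C g"
    using D Cb by (intro continuous_at_imp_continuous_on ballI) (blast intro: has_derivative_continuous)
  then obtain y0 where y0: "y0 \<in> C" "\<And>y. y \<in> C \<Longrightarrow> g y0 \<le> g y"
    using continuous_attains_inf[OF cC] by blast
  have "compact (D2 ` C)"
    using cC continuous_on_subset[OF cD2 Cb] compact_continuous_image by blast
  then obtain B where B: "\<And>y. y \<in> C \<Longrightarrow> norm (D2 y) \<le> B"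
    using compact_imp_bounded bounded_iff by (metis imageI)
  define M where "M = real CARD('p) * real CARD('p) * B"
  have "x \<in> C" using r by (simp add: C_def)
  then have B0: "0 \<le> B" by (rule order_trans[OF norm_ge_zero B])
  have M0: "0 \<le> M" using B0 by (simp add: M_def)
  have onD2: "onorm (\<lambda>h. D2 y *v h) \<le> M" if "y \<in> C" for y
  proof -
    have "\<bar>D2 y $ i $ j\<bar> \<le> B" for i j
      using B[OF that] component_le_norm_cart[of "D2 y $ i" j] Finite_Cartesian_Product.norm_nth_le[of "D2 y" i] by linarith
    from onorm_le_matrix_component[OF this] show ?thesis by (simp add: M_def)
  qed
  have lin: "\<bar>g (t + u) - g t - D t \<bullet> u\<bar> \<le> M * (norm u)\<^sup>2" if t: "dist t x < r / 4" and u: "norm u < r / 4" for t u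
  proof -
    let ?S = "cball t (norm u)"
    have "dist s x \<le> r / 2" if "s \<in> ?S" for s
      using that t u dist_triangle[of s x t] by (simp add: dist_commute)
    then have S: "?S \<subseteq> C" by (auto simp: C_def dist_commute)
    have Dl: "norm (D s - D t) \<le> M * norm u" if s: "s \<in> ?S" for s
    proof -
      have "norm (D s - D t) \<le> M * norm (s - t)"
      proof (rule differentiable_bound[where S = ?S and f' = "\<lambda>y h. D2 y *v h"])
        show "(D has_derivative (\<lambda>h. D2 y *v h)) (at y within ?S)" if "y \<in> ?S" for y
          using D2[of y] that S Cb by (blast intro: has_derivative_at_withinI)
      qed (use s onD2 S in auto)
      also have "\<dots> \<le> M * norm u" using s M0 by (intro mult_left_mono) (auto simp: dist_norm norm_minus_commute)
      finally show ?thesis .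
    qed
    have "norm ((g (t + u) - D t \<bullet> (t + u)) - (g t - D t \<bullet> t)) \<le> (M * norm u) * norm (t + u - t)"
    proof (rule differentiable_bound[where S = ?S and f' = "\<lambda>y h. (D y - D t) \<bullet> h" and f = "\<lambda>y. g y - D t \<bullet> y"])
      fix y assume y: "y \<in> ?S"
      have "((\<lambda>y. g y - D t \<bullet> y) has_derivative (\<lambda>h. D y \<bullet> h - D t \<bullet> h)) (at y within ?S)"
        using D[of y] y S Cb by (intro derivative_intros) (blast intro: has_derivative_at_withinI)
      then show "((\<lambda>y. g y - D t \<bullet> y) has_derivative (\<lambda>h. (D y - D t) \<bullet> h)) (at y within ?S)"
        by (simp add: inner_diff_left)
      show "onorm (\<lambda>h. (D y - D t) \<bullet> h) \<le> M * norm u"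
      proof (rule onorm_le)
        fix h
        have "\<bar>(D y - D t) \<bullet> h\<bar> \<le> norm (D y - D t) * norm h" by (rule Cauchy_Schwarz_ineq2)
        also have "\<dots> \<le> M * norm u * norm h" using Dl[OF y] by (intro mult_right_mono) auto
        finally show "norm ((D y - D t) \<bullet> h) \<le> M * norm u * norm h" by simp
      qed
    qed (auto simp: dist_norm)
    then show ?thesis by (simp add: inner_add_right power2_eq_square algebra_simps)
  qed
  show ?thesis
  proof (rule that[of "r / 4" M "g y0"])
    show "0 < g y0" using pos y0(1) Cb by blast
    fix t assume t: "dist t x < r / 4"
    then have "t \<in> C" using r by (simp add: C_def dist_commute)
    then show "g y0 \<le> g t \<and> linear_up_to_quadratic g t (r / 4) M"
      using y0(2) lin[OF t] unfolding linear_up_to_quadratic_def by blast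
  qed (use r M0 in auto)
qed

lemma tensor3_scaleR: "tensor3 S (c *\<^sub>R u) = c ^ 3 * tensor3 S u"
  by (simp add: tensor3_def sum_distrib_left power3_eq_cube algebra_simps)

text \<open>
  A finite bound on the extended-real remainder forces the likelihood to be positive, at \<open>t\<close> and at
  \<open>t + u\<close>; after that the bound is a real inequality and the common factor \<open>a n\<close> cancels.
\<close>

lemma loglik_expansion_from_remainder:
  fixes L :: "real^'p \<Rightarrow> real"
  assumes a: "0 < a" and n: "0 < n"
    and sup: "\<not> (SUP h\<in>{h. norm h / sqrt (a * real n) \<le> \<delta>}.
        \<bar>loglik_remainder \<Theta> L t H S a n h\<bar> - ereal (M / (a * real n) * norm h ^ 4)) > 0"
    and \<delta>: "0 < \<delta>" and u: "norm u \<le> \<delta>"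
  shows "t + u \<in> \<Theta> \<and> 0 < L (t + u) \<and>
    \<bar>(ln (L (t + u)) - ln (L t)) / real n + u \<bullet> (H *v u) / 2 - tensor3 S u / 6\<bar> \<le> M * norm u ^ 4"
proof -
  define N where "N = a * real n"
  have N: "0 < N" using a n by (simp add: N_def)
  have rem: "\<bar>loglik_remainder \<Theta> L t H S a n (sqrt N *\<^sub>R w)\<bar> \<le> ereal (M / N * norm (sqrt N *\<^sub>R w) ^ 4)"
    if "norm w \<le> \<delta>" for w
  proof -
    have "sqrt N *\<^sub>R w \<in> {h. norm h / sqrt (a * real n) \<le> \<delta>}" using that N by (simp add: N_def[symmetric])
    then have "\<bar>loglik_remainder \<Theta> L t H S a n (sqrt N *\<^sub>R w)\<bar> - ereal (M / (a * real n) * norm (sqrt N *\<^sub>R w) ^ 4) \<le> 0"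
      using sup by (meson SUP_upper not_less order_trans)
    then show ?thesis
      by (cases "\<bar>loglik_remainder \<Theta> L t H S a n (sqrt N *\<^sub>R w)\<bar>") (auto simp: N_def)
  qed
  have arg: "t + (sqrt N *\<^sub>R w) /\<^sub>R sqrt (a * real n) = t + w" for w
    using N by (simp add: N_def[symmetric])
  \<comment> \<open>Otherwise the difference of log-likelihoods at \<open>u = 0\<close> is \<open>- \<infinity> - (- \<infinity>) = \<infinity>\<close>.\<close>
  have t: "t \<in> \<Theta> \<and> 0 < L t"
  proof (rule ccontr)
    assume "\<not> ?thesis"
    then have "loglik \<Theta> L t = - \<infinity>" by (auto simp: loglik_def)
    with rem[of 0] \<delta> a show False by (simp add: loglik_remainder_def)
  qed
  have tu: "t + u \<in> \<Theta> \<and> 0 < L (t + u)"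
  proof (rule ccontr)
    assume "\<not> ?thesis"
    then have "loglik \<Theta> L (t + u) = - \<infinity>" by (auto simp: loglik_def)
    moreover have "loglik \<Theta> L t = ereal (ln (L t))" using t by (simp add: loglik_def)
    ultimately show False using rem[OF u] a unfolding loglik_remainder_def arg by simp
  qed
  define l where "l = (ln (L (t + u)) - ln (L t)) / real n"
  define Q where "Q = u \<bullet> (H *v u)"
  define \<tau> where "\<tau> = tensor3 S u"
  define X where "X = l + Q / 2 - \<tau> / 6"
  have s3: "sqrt N ^ 3 = N * sqrt N" "sqrt N * sqrt N = N" "sqrt N ^ 4 = N * N"
    using N by (simp_all add: power3_eq_cube power4_eq_xxxx)
  have "loglik_remainder \<Theta> L t H S a n (sqrt N *\<^sub>R u) = ereal (N * X)"
  proof -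
    have logs: "loglik \<Theta> L t = ereal (ln (L t))" "loglik \<Theta> L (t + u) = ereal (ln (L (t + u)))"
      using t tu by (simp_all add: loglik_def)
    have "(sqrt N *\<^sub>R u) \<bullet> (H *v (sqrt N *\<^sub>R u)) = (sqrt N * sqrt N) * Q"
      by (simp add: matrix_vector_mult_scaleR Q_def del: real_sqrt_mult_self)
    then have quad: "(sqrt N *\<^sub>R u) \<bullet> (H *v (sqrt N *\<^sub>R u)) = N * Q" by (simp only: s3)
    have cub: "tensor3 S (sqrt N *\<^sub>R u) / (6 * sqrt N) = N * \<tau> / 6"
      using N by (simp add: tensor3_scaleR s3 \<tau>_def)
    have lin: "a * (ln (L (t + u)) - ln (L t)) = N * l"
      using n by (simp add: N_def l_def)
    have "loglik_remainder \<Theta> L t H S a n (sqrt N *\<^sub>R u)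
       = ereal (a * (ln (L (t + u)) - ln (L t)) + (N * Q / 2 - N * \<tau> / 6))"
      unfolding loglik_remainder_def arg quad logs by (simp add: N_def[symmetric] cub)
    then show ?thesis unfolding lin by (simp add: X_def algebra_simps)
  qed
  then have "\<bar>N * X\<bar> \<le> M / N * norm (sqrt N *\<^sub>R u) ^ 4" using rem[OF u] by simp
  also have "\<dots> = N * (M * norm u ^ 4)" using N by (simp add: power_mult_distrib s3)
  finally have "N * \<bar>X\<bar> \<le> N * (M * norm u ^ 4)" using N by (simp add: abs_mult)
  then have "\<bar>X\<bar> \<le> M * norm u ^ 4" using N by simp
  then show ?thesis using tu by (simp add: X_def l_def Q_def \<tau>_def)
qed

text \<open>
  As \<open>G\<close> is nonpositive, the expansion bounds the cubic form from above on the sphere of radius \<open>\<delta>\<close>.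
  Homogeneity extends the bound to all \<open>u\<close>, and replacing \<open>u\<close> by \<open>- u\<close> gives the bound from below.
\<close>

lemma tensor3_bounded_at_maximum:
  fixes S :: "real^'p^'p^'p" and G :: "real^'p \<Rightarrow> real"
  assumes \<delta>: "0 < \<delta>" and M: "0 \<le> M"
    and max: "\<And>u. norm u \<le> \<delta> \<Longrightarrow> G u \<le> 0"
    and ex: "\<And>u. norm u \<le> \<delta> \<Longrightarrow> \<bar>G u + u \<bullet> (H *v u) / 2 - tensor3 S u / 6\<bar> \<le> M * norm u ^ 4"
    and H: "\<And>u. u \<bullet> (H *v u) \<le> \<Lambda> * (norm u)\<^sup>2"
  shows "\<bar>tensor3 S u / 6\<bar> \<le> (\<Lambda> * \<delta>\<^sup>2 / 2 + M * \<delta> ^ 4) / \<delta> ^ 3 * norm u ^ 3"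
proof -
  have le: "tensor3 S w / 6 \<le> \<Lambda> * \<delta>\<^sup>2 / 2 + M * \<delta> ^ 4" if w: "norm w = \<delta>" for w
    using max[of w] ex[of w] H[of w] w by (simp add: abs_le_iff)
  have le': "tensor3 S u / 6 \<le> (\<Lambda> * \<delta>\<^sup>2 / 2 + M * \<delta> ^ 4) / \<delta> ^ 3 * norm u ^ 3" for u
  proof (cases "u = 0")
    case True
    then show ?thesis by (simp add: tensor3_def)
  next
    case False
    have "tensor3 S ((\<delta> / norm u) *\<^sub>R u) / 6 \<le> \<Lambda> * \<delta>\<^sup>2 / 2 + M * \<delta> ^ 4"
      using \<delta> False by (intro le) simp
    then show ?thesis using \<delta> False by (simp add: tensor3_scaleR field_simps)
  qed
  show ?thesis
    using le'[of u] le'[of "- u"] tensor3_scaleR[of S "- 1" u] by (simp add: abs_le_iff)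
qed

lemma likelihood_decay_from_separation:
  fixes L :: "real^'p \<Rightarrow> real"
  assumes n: "0 < n" and t: "t \<in> \<Theta>" "0 < L t"
    and sup: "\<not> (SUP \<theta>\<in>- ball t \<delta>. ereal (1 / real n) * loglik \<Theta> L \<theta>
             - ereal (1 / real n) * loglik \<Theta> L t) > ereal (- c)"
    and \<theta>: "\<theta> \<in> \<Theta>" "\<delta> \<le> norm (\<theta> - t)" "0 \<le> L \<theta>"
  shows "L \<theta> \<le> L t * exp (- (c * real n))"
proof (cases "L \<theta> = 0")
  case True
  then show ?thesis using t by simp
next
  case False
  then have L: "0 < L \<theta>" using \<theta> by simp
  have "\<theta> \<in> - ball t \<delta>" using \<theta> by (simp add: dist_norm norm_minus_commute)
  then have "ereal (1 / real n) * loglik \<Theta> L \<theta> - ereal (1 / real n) * loglik \<Theta> L t \<le> ereal (- c)"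
    using sup by (meson SUP_upper not_less order_trans)
  then have "1 / real n * ln (L \<theta>) - 1 / real n * ln (L t) \<le> - c"
    using L t \<theta> by (simp add: loglik_def)
  then have "ln (L \<theta>) \<le> ln (L t) - c * real n" using n by (simp add: field_simps)
  then have "exp (ln (L \<theta>)) \<le> exp (ln (L t) - c * real n)" by simp
  then show ?thesis using L t by (simp add: exp_diff exp_minus field_simps)
qed

lemma linear_up_to_quadratic_from_remainder:
  fixes b :: "real^'p \<Rightarrow> real"
  assumes N: "0 < N"
    and sup: "\<not> (SUP h\<in>{h. norm h / sqrt N \<le> \<delta>}.
             ereal (\<bar>b (t + h /\<^sub>R sqrt N) - b t - (v \<bullet> h) / sqrt N\<bar> - M / N * (norm h)\<^sup>2)) > 0"
  shows "linear_up_to_quadratic b t \<delta> M"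
proof -
  have "\<bar>b (t + u) - b t - v \<bullet> u\<bar> \<le> M * (norm u)\<^sup>2" if "norm u < \<delta>" for u
  proof -
    let ?h = "sqrt N *\<^sub>R u"
    have "?h \<in> {h. norm h / sqrt N \<le> \<delta>}" using that N by simp
    then have "ereal (\<bar>b (t + ?h /\<^sub>R sqrt N) - b t - (v \<bullet> ?h) / sqrt N\<bar> - M / N * (norm ?h)\<^sup>2) \<le> 0"
      using sup by (meson SUP_upper not_less order_trans)
    then show ?thesis using N by (simp add: power_mult_distrib)
  qed
  then show ?thesis unfolding linear_up_to_quadratic_def by blast
qed

section \<open>Events of probability close to one\<close>

lemma prob_of_mono:
  "(\<And>x. x \<in> space M \<Longrightarrow> Q x \<Longrightarrow> R x) \<Longrightarrow> prob_of M Q \<le> prob_of M R"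
  unfolding prob_of_def by (intro outer_measure_of_mono) auto

text \<open>
  Both events are contained in measurable sets of the same outer probability.
\<close>

lemma prob_of_disj: "prob_of M (\<lambda>x. Q x \<or> R x) \<le> prob_of M Q + prob_of M R"
proof -
  obtain E where E: "E \<in> sets M" "{x \<in> space M. Q x} \<subseteq> E" "prob_of M Q = emeasure M E"
    using outer_measure_of_attain[of "{x \<in> space M. Q x}" M] by (auto simp: prob_of_def)
  obtain F where F: "F \<in> sets M" "{x \<in> space M. R x} \<subseteq> F" "prob_of M R = emeasure M F"
    using outer_measure_of_attain[of "{x \<in> space M. R x}" M] by (auto simp: prob_of_def)
  have "prob_of M (\<lambda>x. Q x \<or> R x) \<le> outer_measure_of M (E \<union> F)"
    unfolding prob_of_def using E(2) F(2) by (intro outer_measure_of_mono) auto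
  also have "\<dots> = emeasure M (E \<union> F)" using E F by simp
  also have "\<dots> \<le> emeasure M E + emeasure M F" by (rule emeasure_subadditive[OF E(1) F(1)])
  finally show ?thesis by (simp add: E F)
qed

lemma prob_of_AE:
  assumes "AE x in M. Q x"
  shows "prob_of M (\<lambda>x. \<not> Q x) = 0"
proof -
  obtain E where E: "{x \<in> space M. \<not> Q x} \<subseteq> E" "emeasure M E = 0" "E \<in> sets M"
    using AE_E[OF assms] by blast
  have "prob_of M (\<lambda>x. \<not> Q x) \<le> outer_measure_of M E"
    unfolding prob_of_def by (rule outer_measure_of_mono[OF E(1)])
  then show ?thesis using E by simp
qed

text \<open>
  The level \<open>\<epsilon>\<close> is explicit because the constants of the expansion depend on it.
\<close>

definition likely :: "(nat \<Rightarrow> 'w measure) \<Rightarrow> real \<Rightarrow> (nat \<Rightarrow> 'w \<Rightarrow> bool) \<Rightarrow> bool" where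
  "likely P \<epsilon> Q \<longleftrightarrow> (\<forall>\<^sub>F n in sequentially. prob_of (P n) (\<lambda>x. \<not> Q n x) < ennreal \<epsilon>)"

lemma likely_conj:
  assumes "likely P \<epsilon>1 Q" "likely P \<epsilon>2 R" "0 < \<epsilon>1" "0 < \<epsilon>2"
  shows "likely P (\<epsilon>1 + \<epsilon>2) (\<lambda>n x. Q n x \<and> R n x)"
proof -
  have "\<forall>\<^sub>F n in sequentially. prob_of (P n) (\<lambda>x. \<not> Q n x) < ennreal \<epsilon>1 \<and>
      prob_of (P n) (\<lambda>x. \<not> R n x) < ennreal \<epsilon>2"
    using assms(1,2) by (simp add: likely_def eventually_conj)
  then show ?thesis unfolding likely_def
  proof (rule eventually_mono)
    fix n assume *: "prob_of (P n) (\<lambda>x. \<not> Q n x) < ennreal \<epsilon>1 \<and> prob_of (P n) (\<lambda>x. \<not> R n x) < ennreal \<epsilon>2"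
    have "prob_of (P n) (\<lambda>x. \<not> (Q n x \<and> R n x)) \<le> prob_of (P n) (\<lambda>x. \<not> Q n x) + prob_of (P n) (\<lambda>x. \<not> R n x)"
      using prob_of_disj[of "P n" "\<lambda>x. \<not> Q n x" "\<lambda>x. \<not> R n x"] by simp
    also have "\<dots> < ennreal \<epsilon>1 + ennreal \<epsilon>2" using * by (intro add_strict_mono) auto
    also have "\<dots> = ennreal (\<epsilon>1 + \<epsilon>2)" using assms by simp
    finally show "prob_of (P n) (\<lambda>x. \<not> (Q n x \<and> R n x)) < ennreal (\<epsilon>1 + \<epsilon>2)" .
  qed
qed

lemma likely_mono:
  assumes "likely P \<epsilon> Q" "\<forall>\<^sub>F n in sequentially. \<forall>x\<in>space (P n). Q n x \<longrightarrow> R n x"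
  shows "likely P \<epsilon> R"
  unfolding likely_def
  using assms(1)[unfolded likely_def] assms(2)
proof eventually_elim
  case (elim n)
  have "prob_of (P n) (\<lambda>x. \<not> R n x) \<le> prob_of (P n) (\<lambda>x. \<not> Q n x)"
    using elim(2) by (intro prob_of_mono) auto
  then show ?case using elim(1) by (rule le_less_trans)
qed

lemma likely_AE:
  assumes "\<And>n. 0 < n \<Longrightarrow> AE x in P n. Q n x" "0 < \<epsilon>"
  shows "likely P \<epsilon> Q"
  unfolding likely_def using eventually_gt_at_top[of 0]
  by eventually_elim (simp add: prob_of_AE[OF assms(1)] assms(2))

lemma likely_tendsto_in_prob:
  assumes "tendsto_in_prob P Y c" "0 < r" "0 < \<epsilon>"
  shows "likely P \<epsilon> (\<lambda>n x. dist (Y n x) c \<le> r)"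
proof -
  have "(\<lambda>n. prob_of (P n) (\<lambda>x. dist (Y n x) c > r)) \<longlonglongrightarrow> 0"
    using assms by (simp add: tendsto_in_prob_def)
  then have "\<forall>\<^sub>F n in sequentially. prob_of (P n) (\<lambda>x. dist (Y n x) c > r) < ennreal \<epsilon>"
    using assms(3) by (intro order_tendstoD) auto
  then show ?thesis by (simp add: likely_def not_le)
qed

lemma bigO_prob_inverse_rateI:
  fixes Y :: "nat \<Rightarrow> 'w \<Rightarrow> real"
  assumes r: "\<And>n. 0 < n \<Longrightarrow> 0 < r n"
    and Y: "\<And>\<epsilon>. 0 < \<epsilon> \<Longrightarrow> \<exists>K\<ge>0. likely P \<epsilon> (\<lambda>n x. \<bar>Y n x\<bar> \<le> K / r n)"
  shows "bigO_prob P Y (\<lambda>n. 1 / r n)"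
  unfolding bigO_prob_def
proof (intro allI impI)
  fix \<epsilon> :: real assume "0 < \<epsilon>"
  then obtain K where K: "0 \<le> K" "likely P \<epsilon> (\<lambda>n x. \<bar>Y n x\<bar> \<le> K / r n)" using Y by blast
  have "likely P \<epsilon> (\<lambda>n x. \<not> norm (Y n x /\<^sub>R (1 / r n)) > K + 1)"
    using K(2)
  proof (rule likely_mono)
    show "\<forall>\<^sub>F n in sequentially. \<forall>x\<in>space (P n).
        \<bar>Y n x\<bar> \<le> K / r n \<longrightarrow> \<not> norm (Y n x /\<^sub>R (1 / r n)) > K + 1"
      using eventually_gt_at_top[of 0]
    proof eventually_elim
      case (elim n)
      then show ?case using r[OF elim] by (auto simp: abs_mult field_simps)
    qed
  qed
  then show "\<exists>M>0. \<forall>\<^sub>F n in sequentially. prob_of (P n) (\<lambda>x. norm (Y n x /\<^sub>R (1 / r n)) > M) < ennreal \<epsilon>"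
    using K(1) by (intro exI[of _ "K + 1"]) (simp add: likely_def)
qed

lemma density_set_integrable:
  assumes "open \<Theta>" "is_density (restrict_space lborel \<Theta>) \<pi>"
  shows "set_integrable lborel \<Theta> \<pi>"
proof -
  have "integrable (restrict_space lborel \<Theta>) \<pi>"
  proof (rule integrableI_nonneg)
    show "\<pi> \<in> borel_measurable (restrict_space lborel \<Theta>)" using assms(2) by (simp add: is_density_def)
    show "AE x in restrict_space lborel \<Theta>. 0 \<le> \<pi> x"
      using assms(2) by (intro AE_I2) (simp add: is_density_def)
    show "(\<integral>\<^sup>+x. ennreal (\<pi> x) \<partial>restrict_space lborel \<Theta>) < \<infinity>"
      using assms(2) by (simp add: is_density_def)
  qed
  then show ?thesis
    using assms(1) by (subst (asm) integrable_restrict_space) (simp_all add: set_integrable_def)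
qed

section \<open>The expansion for random samples\<close>

text \<open>
  Six events of probability close to one make a sample regular: the matrix lies in a compact set, the
  expansions of the log-likelihood and of \<open>b\<close> hold, the likelihood is separated from its maximum
  away from \<open>\<theta>hat\<close>, \<open>\<theta>hat\<close> maximises the likelihood, and \<open>\<theta>hat\<close> is close to \<open>\<theta>star\<close>.  The radius
  \<open>\<delta>\<close> is chosen after the bound \<open>C\<close> on the cubic term and before the separation constant \<open>c\<close>.
\<close>

lemma regular_sample_likely:
  fixes P :: "nat \<Rightarrow> 'w measure" and \<Theta> :: "(real^'p) set" and f :: "nat \<Rightarrow> 'w \<Rightarrow> real^'p \<Rightarrow> real"
    and \<theta>hat :: "nat \<Rightarrow> 'w \<Rightarrow> real^'p" and b \<pi> :: "real^'p \<Rightarrow> real"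
  assumes f: "\<And>n x. 0 < n \<Longrightarrow> x \<in> space (P n) \<Longrightarrow>
      set_borel_measurable borel \<Theta> (f n x) \<and> (\<forall>\<theta>\<in>\<Theta>. 0 \<le> f n x \<theta>)"
    and \<alpha>: "\<And>n. 0 < \<alpha> n"
    and mle: "\<And>n. 0 < n \<Longrightarrow> AE x in P n. \<forall>\<theta>\<in>\<Theta>. f n x \<theta> \<le> f n x (\<theta>hat n x)"
    and cons: "tendsto_in_prob P \<theta>hat \<theta>star"
    and prior: "0 < r" "C2_on (ball \<theta>star r) \<pi>" "\<And>\<theta>. \<theta> \<in> ball \<theta>star r \<Longrightarrow> 0 < \<pi> \<theta>"
    and A2: "assm_A2 P \<Theta> f \<theta>hat \<alpha> H" and A3: "assm_A3 P \<Theta> f \<theta>hat"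
    and Lap: "assm_Lap P \<Theta> \<theta>hat \<alpha> b" and \<epsilon>: "0 < \<epsilon>"
  obtains \<kappa> D \<delta> M C c M' \<pi>0 where "0 < \<kappa>" "0 < \<delta>" "0 < c" "0 < \<pi>0"
    "0 \<le> M" "0 \<le> C" "0 \<le> M'" "0 \<le> D" "C * \<delta> + M * \<delta>\<^sup>2 \<le> \<kappa> / 4"
    "likely P \<epsilon> (\<lambda>n x. peaked_likelihood \<Theta> (f n x) (\<theta>hat n x) (real n) (H n x) \<kappa> D \<delta> M C c \<and>
       linear_up_to_quadratic b (\<theta>hat n x) \<delta> M' \<and> linear_up_to_quadratic \<pi> (\<theta>hat n x) \<delta> M' \<and>
       \<pi>0 \<le> \<pi> (\<theta>hat n x))"
proof -
  define e where "e = \<epsilon> / 6"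
  have e: "0 < e" using \<epsilon> by (simp add: e_def)
  obtain K where K: "compact K" "K \<subseteq> {A. pos_def A}" and likH: "likely P e (\<lambda>n x. H n x \<in> K)"
    using A2 e unfolding assm_A2_def pos_def_in_prob_def likely_def by blast
  obtain \<kappa> \<Lambda> D where HK: "0 < \<kappa>" "0 \<le> \<Lambda>" "0 \<le> D"
    "\<And>A u. A \<in> K \<Longrightarrow> \<kappa> * (norm u)\<^sup>2 \<le> u \<bullet> (A *v u)"
    "\<And>A u. A \<in> K \<Longrightarrow> u \<bullet> (A *v u) \<le> \<Lambda> * (norm u)\<^sup>2"
    "\<And>A. A \<in> K \<Longrightarrow> det A \<le> D"
    using compact_pos_def_bounds[OF K] by metis
  obtain S :: "nat \<Rightarrow> 'w \<Rightarrow> real^'p^'p^'p" and M1 \<delta>1 where \<delta>1: "0 < \<delta>1"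
    and likA2: "likely P e (\<lambda>n x. \<not> (SUP h\<in>{h. norm h / sqrt (\<alpha> n * real n) \<le> \<delta>1}.
             \<bar>loglik_remainder \<Theta> (f n x) (\<theta>hat n x) (H n x) (S n x) (\<alpha> n) n h\<bar>
             - ereal (M1 / (\<alpha> n * real n) * norm h ^ 4)) > 0)"
    using A2 e unfolding assm_A2_def likely_def not_not by blast
  obtain v :: "nat \<Rightarrow> 'w \<Rightarrow> real^'p" and Mb \<delta>2 where \<delta>2: "0 < \<delta>2"
    and likLap: "likely P e (\<lambda>n x. \<not> (SUP h\<in>{h. norm h / sqrt (\<alpha> n * real n) \<le> \<delta>2}.
             ereal (\<bar>b (\<theta>hat n x + h /\<^sub>R sqrt (\<alpha> n * real n)) - b (\<theta>hat n x)
                     - (v n x \<bullet> h) / sqrt (\<alpha> n * real n)\<bar>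
                    - Mb / (\<alpha> n * real n) * (norm h)\<^sup>2)) > 0)"
    using Lap e unfolding assm_Lap_def likely_def not_not by blast
  obtain \<delta>3 M\<pi> \<pi>0 where \<delta>3: "0 < \<delta>3" "0 \<le> M\<pi>" "0 < \<pi>0"
    and \<pi>: "\<And>t. dist t \<theta>star < \<delta>3 \<Longrightarrow> \<pi>0 \<le> \<pi> t \<and> linear_up_to_quadratic \<pi> t \<delta>3 M\<pi>"
    using C2_linear_up_to_quadratic[OF prior] by metis
  define M where "M = max M1 0"
  define C where "C = (\<Lambda> * \<delta>1\<^sup>2 / 2 + M * \<delta>1 ^ 4) / \<delta>1 ^ 3"
  \<comment> \<open>The last bound makes the cubic and quartic terms at most half of the quadratic one.\<close>
  define \<delta> where "\<delta> = min (min \<delta>1 (min \<delta>2 \<delta>3)) (min 1 (\<kappa> / (4 * (C + M + 1))))"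
  define M' where "M' = max Mb M\<pi>"
  have M: "0 \<le> M" "M1 \<le> M" by (simp_all add: M_def)
  have C: "0 \<le> C" using HK(2) M \<delta>1 by (simp add: C_def)
  have \<delta>: "0 < \<delta>" "\<delta> \<le> \<delta>1" "\<delta> \<le> \<delta>2" "\<delta> \<le> \<delta>3" "\<delta> \<le> 1" "\<delta> \<le> \<kappa> / (4 * (C + M + 1))"
    using \<delta>1 \<delta>2 \<delta>3 HK(1) C M by (simp_all add: \<delta>_def min_le_iff_disj)
  have M': "0 \<le> M'" "Mb \<le> M'" "M\<pi> \<le> M'" using \<delta>3 by (simp_all add: M'_def)
  have small: "C * \<delta> + M * \<delta>\<^sup>2 \<le> \<kappa> / 4"
  proof -
    have "\<delta>\<^sup>2 \<le> \<delta>" using \<delta> by (simp add: power2_eq_square mult_left_le)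
    then have "C * \<delta> + M * \<delta>\<^sup>2 \<le> C * \<delta> + M * \<delta>" using M by (simp add: mult_left_mono)
    also have "\<dots> \<le> (C + M + 1) * \<delta>" using \<delta> by (simp add: algebra_simps)
    also have "\<dots> \<le> (C + M + 1) * (\<kappa> / (4 * (C + M + 1)))" using \<delta> C M by (intro mult_left_mono) auto
    also have "\<dots> = \<kappa> / 4"
    proof -
      have "C + M + 1 \<noteq> 0" using C M by linarith
      then show ?thesis by (simp add: field_simps)
    qed
    finally show ?thesis .
  qed
  obtain c where c: "0 < c" and likA3: "likely P e (\<lambda>n x. \<not> (SUP \<theta>\<in>- ball (\<theta>hat n x) \<delta>.
             ereal (1 / real n) * loglik \<Theta> (f n x) \<theta>
             - ereal (1 / real n) * loglik \<Theta> (f n x) (\<theta>hat n x)) > ereal (- c))"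
    using A3 e \<delta>(1) unfolding assm_A3_def likely_def not_not by blast
  have lik_mle: "likely P e (\<lambda>n x. \<forall>\<theta>\<in>\<Theta>. f n x \<theta> \<le> f n x (\<theta>hat n x))"
    by (rule likely_AE[OF mle e])
  have lik_cons: "likely P e (\<lambda>n x. dist (\<theta>hat n x) \<theta>star \<le> \<delta>3 / 2)"
    using \<delta>3 by (intro likely_tendsto_in_prob[OF cons _ e]) simp
  have e_sums: "0 < e + e" "0 < e + (e + e)" "0 < e + (e + (e + e))" "0 < e + (e + (e + (e + e)))"
    using e by simp_all
  note lik = likely_conj[OF likH likely_conj[OF likA2 likely_conj[OF likLap likely_conj[OF likA3
    likely_conj[OF lik_mle lik_cons e e] e e_sums(1)] e e_sums(2)] e e_sums(3)] e e_sums(4)]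
  have "likely P \<epsilon> (\<lambda>n x. peaked_likelihood \<Theta> (f n x) (\<theta>hat n x) (real n) (H n x) \<kappa> D \<delta> M C c \<and>
       linear_up_to_quadratic b (\<theta>hat n x) \<delta> M' \<and> linear_up_to_quadratic \<pi> (\<theta>hat n x) \<delta> M' \<and>
       \<pi>0 \<le> \<pi> (\<theta>hat n x))"
  proof -
    have sum: "e + (e + (e + (e + (e + e)))) = \<epsilon>" by (simp add: e_def)
    show ?thesis
    proof (rule likely_mono[OF lik[unfolded sum]])
      show "\<forall>\<^sub>F n in sequentially. \<forall>x\<in>space (P n).
        (H n x \<in> K \<and>
         \<not> (SUP h\<in>{h. norm h / sqrt (\<alpha> n * real n) \<le> \<delta>1}.
             \<bar>loglik_remainder \<Theta> (f n x) (\<theta>hat n x) (H n x) (S n x) (\<alpha> n) n h\<bar>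
             - ereal (M1 / (\<alpha> n * real n) * norm h ^ 4)) > 0 \<and>
         \<not> (SUP h\<in>{h. norm h / sqrt (\<alpha> n * real n) \<le> \<delta>2}.
             ereal (\<bar>b (\<theta>hat n x + h /\<^sub>R sqrt (\<alpha> n * real n)) - b (\<theta>hat n x)
                     - (v n x \<bullet> h) / sqrt (\<alpha> n * real n)\<bar>
                    - Mb / (\<alpha> n * real n) * (norm h)\<^sup>2)) > 0 \<and>
         \<not> (SUP \<theta>\<in>- ball (\<theta>hat n x) \<delta>.
             ereal (1 / real n) * loglik \<Theta> (f n x) \<theta>
             - ereal (1 / real n) * loglik \<Theta> (f n x) (\<theta>hat n x)) > ereal (- c) \<and>
         (\<forall>\<theta>\<in>\<Theta>. f n x \<theta> \<le> f n x (\<theta>hat n x)) \<and> dist (\<theta>hat n x) \<theta>star \<le> \<delta>3 / 2) \<longrightarrow>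
        peaked_likelihood \<Theta> (f n x) (\<theta>hat n x) (real n) (H n x) \<kappa> D \<delta> M C c \<and>
         linear_up_to_quadratic b (\<theta>hat n x) \<delta> M' \<and> linear_up_to_quadratic \<pi> (\<theta>hat n x) \<delta> M' \<and>
         \<pi>0 \<le> \<pi> (\<theta>hat n x)"
        using eventually_gt_at_top[of 0]
      proof eventually_elim
        case (elim n)
        show ?case
        proof (intro ballI impI, elim conjE)
          fix x
          let ?t = "\<theta>hat n x" and ?L = "f n x" and ?H = "H n x"
          assume x: "x \<in> space (P n)" and HKx: "?H \<in> K"
            and sup1: "\<not> (SUP h\<in>{h. norm h / sqrt (\<alpha> n * real n) \<le> \<delta>1}.
             \<bar>loglik_remainder \<Theta> ?L ?t ?H (S n x) (\<alpha> n) n h\<bar>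
             - ereal (M1 / (\<alpha> n * real n) * norm h ^ 4)) > 0"
            and sup2: "\<not> (SUP h\<in>{h. norm h / sqrt (\<alpha> n * real n) \<le> \<delta>2}.
             ereal (\<bar>b (?t + h /\<^sub>R sqrt (\<alpha> n * real n)) - b ?t
                     - (v n x \<bullet> h) / sqrt (\<alpha> n * real n)\<bar>
                    - Mb / (\<alpha> n * real n) * (norm h)\<^sup>2)) > 0"
            and sup3: "\<not> (SUP \<theta>\<in>- ball ?t \<delta>.
             ereal (1 / real n) * loglik \<Theta> ?L \<theta>
             - ereal (1 / real n) * loglik \<Theta> ?L ?t) > ereal (- c)"
            and mx: "\<forall>\<theta>\<in>\<Theta>. ?L \<theta> \<le> ?L ?t" and cl: "dist ?t \<theta>star \<le> \<delta>3 / 2"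
          have L: "set_borel_measurable borel \<Theta> ?L" "\<And>\<theta>. \<theta> \<in> \<Theta> \<Longrightarrow> 0 \<le> ?L \<theta>"
            using f[OF elim x] by auto
          note ex1 = loglik_expansion_from_remainder[OF \<alpha> elim sup1 \<delta>1]
          have ex: "?t + u \<in> \<Theta>" "0 < ?L (?t + u)"
            "\<bar>(ln (?L (?t + u)) - ln (?L ?t)) / real n + u \<bullet> (?H *v u) / 2 - tensor3 (S n x) u / 6\<bar> \<le> M * norm u ^ 4"
            if "norm u \<le> \<delta>1" for u
          proof -
            have "M1 * norm u ^ 4 \<le> M * norm u ^ 4" using M by (intro mult_right_mono) auto
            with ex1[OF that] show "?t + u \<in> \<Theta>" "0 < ?L (?t + u)"
              "\<bar>(ln (?L (?t + u)) - ln (?L ?t)) / real n + u \<bullet> (?H *v u) / 2 - tensor3 (S n x) u / 6\<bar> \<le> M * norm u ^ 4"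
              by linarith+
          qed
          have t: "?t \<in> \<Theta>" "0 < ?L ?t" using ex(1,2)[of 0] \<delta>1 by auto
          have "(ln (?L (?t + u)) - ln (?L ?t)) / real n \<le> 0" if "norm u \<le> \<delta>1" for u
            using mx ex(1,2)[OF that] t elim by (simp add: divide_nonpos_pos)
          from tensor3_bounded_at_maximum[OF \<delta>1 M(1) this ex(3) HK(5)[OF HKx]]
          have S_le: "\<bar>tensor3 (S n x) u / 6\<bar> \<le> C * norm u ^ 3" for u by (simp add: C_def)
          have T: "(\<lambda>u. tensor3 (S n x) u / 6) \<in> borel_measurable borel"
            unfolding tensor3_def by (intro borel_measurable_continuous_onI continuous_intros) auto
          have "peaked_likelihood \<Theta> ?L ?t (real n) ?H \<kappa> D \<delta> M C c"
            unfolding peaked_likelihood_def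
          proof (intro conjI exI[of _ "\<lambda>u. tensor3 (S n x) u / 6"] allI impI ballI)
            show "pos_def ?H" using HKx K by blast
            show "tensor3 (S n x) (- u) / 6 = - (tensor3 (S n x) u / 6)" for u
              using tensor3_scaleR[of "S n x" "- 1" u] by simp
            show "?L \<theta> \<le> ?L ?t * exp (- (c * real n))" if "\<theta> \<in> \<Theta>" "\<delta> \<le> norm (\<theta> - ?t)" for \<theta>
              by (rule likelihood_decay_from_separation[OF elim t sup3 that L(2)[OF that(1)]])
          qed (use L HK(4,6)[OF HKx] S_le T ex \<delta> in auto)
          moreover have "linear_up_to_quadratic b ?t \<delta> M'"
            using linear_up_to_quadratic_from_remainder[OF _ sup2] \<alpha>[of n] elim \<delta> M'
            by (auto intro: linear_up_to_quadratic_mono)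
          moreover have "\<pi>0 \<le> \<pi> ?t \<and> linear_up_to_quadratic \<pi> ?t \<delta> M'"
            using \<pi>[of ?t] cl \<delta>3 \<delta> M' by (auto intro: linear_up_to_quadratic_mono)
          ultimately show "peaked_likelihood \<Theta> ?L ?t (real n) ?H \<kappa> D \<delta> M C c \<and>
             linear_up_to_quadratic b ?t \<delta> M' \<and> linear_up_to_quadratic \<pi> ?t \<delta> M' \<and> \<pi>0 \<le> \<pi> ?t"
            by simp
        qed
      qed
    qed
  qed
  then show ?thesis
    using that[OF HK(1) \<delta>(1) c \<delta>3(3) M(1) C M'(1) HK(3) small] by blast
qed

theorem lemma1:
  fixes \<mu> :: "(real^'d) measure" and \<X> :: "(real^'d) set"
    and f0 :: "nat \<Rightarrow> (nat \<Rightarrow> real^'d) \<Rightarrow> real"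
    and \<Theta> :: "(real^'p) set"
    and f :: "nat \<Rightarrow> (nat \<Rightarrow> real^'d) \<Rightarrow> real^'p \<Rightarrow> real"
    and \<pi> q :: "real^'p \<Rightarrow> real"
    and \<theta>hat :: "nat \<Rightarrow> (nat \<Rightarrow> real^'d) \<Rightarrow> real^'p" and \<theta>star :: "real^'p"
    and \<alpha> :: "nat \<Rightarrow> real"
    and H :: "nat \<Rightarrow> (nat \<Rightarrow> real^'d) \<Rightarrow> real^'p^'p"
  assumes model: "statistical_model \<mu> \<X> f0 \<Theta> f"
    and prior: "is_density (restrict_space lborel \<Theta>) \<pi>"
    and alpha_pos: "\<And>n. 0 < \<alpha> n"
    and alpha_lim: "filterlim (\<lambda>n. \<alpha> n * real n) at_top sequentially"
    and proper: "\<And>n. 0 < n \<Longrightarrow>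
      AE x in true_law \<mu> \<X> f0 n. proper_posterior \<Theta> \<pi> (f n x) (\<alpha> n)"
    and A0: "assm_A0 (true_law \<mu> \<X> f0) \<Theta> f \<theta>hat \<theta>star"
    and A1: "assm_A1 \<Theta> \<pi> \<theta>star"
    and A2: "assm_A2 (true_law \<mu> \<X> f0) \<Theta> f \<theta>hat \<alpha> H"
    and A3: "assm_A3 (true_law \<mu> \<X> f0) \<Theta> f \<theta>hat"
    and Lap: "assm_Lap (true_law \<mu> \<X> f0) \<Theta> \<theta>hat \<alpha> (\<lambda>\<theta>. q \<theta> * \<pi> \<theta>)"
  shows "bigO_prob (true_law \<mu> \<X> f0)
           (\<lambda>n x. (LINT \<theta>:\<Theta>|lborel. q \<theta> * \<pi> \<theta> * f n x \<theta> powr \<alpha> n)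
                    / (f n x (\<theta>hat n x) powr \<alpha> n * det (H n x) powr (- 1 / 2)
                       * (2 * pi / (\<alpha> n * real n)) powr (real CARD('p) / 2))
                  - q (\<theta>hat n x) * \<pi> (\<theta>hat n x))
           (\<lambda>n. 1 / (\<alpha> n * real n)) \<and>
         bigO_prob (true_law \<mu> \<X> f0)
           (\<lambda>n x. posterior_mean \<Theta> \<pi> (f n x) (\<alpha> n) q - q (\<theta>hat n x))
           (\<lambda>n. 1 / (\<alpha> n * real n)) \<and>
         (\<forall>\<alpha>hat :: nat \<Rightarrow> (nat \<Rightarrow> real^'d) \<Rightarrow> real.
           (\<forall>n>0. AE x in true_law \<mu> \<X> f0 n.
              0 < \<alpha>hat n x \<and> proper_posterior \<Theta> \<pi> (f n x) (\<alpha>hat n x)) \<and>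
           tendsto_in_prob (true_law \<mu> \<X> f0) (\<lambda>n x. \<alpha>hat n x / \<alpha> n) 1 \<longrightarrow>
           bigO_prob (true_law \<mu> \<X> f0)
             (\<lambda>n x. posterior_mean \<Theta> \<pi> (f n x) (\<alpha>hat n x) q - q (\<theta>hat n x))
             (\<lambda>n. 1 / (\<alpha> n * real n)))"
proof -
  let ?P = "true_law \<mu> \<X> f0"
  have \<Theta>: "open \<Theta>" and cons: "tendsto_in_prob ?P \<theta>hat \<theta>star"
    using A0 by (auto simp: assm_A0_def)
  have mle: "AE x in ?P n. \<forall>\<theta>\<in>\<Theta>. f n x \<theta> \<le> f n x (\<theta>hat n x)" if n: "0 < n" for n
  proof -
    have "AE x in ?P n. \<forall>\<theta>. is_arg_max (f n x) (\<lambda>\<theta>. \<theta> \<in> \<Theta>) \<theta> \<longleftrightarrow> \<theta> = \<theta>hat n x"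
      using A0 n by (simp add: assm_A0_def)
    then show ?thesis
    proof (rule AE_mp, intro AE_I2 impI)
      fix x assume "\<forall>\<theta>. is_arg_max (f n x) (\<lambda>\<theta>. \<theta> \<in> \<Theta>) \<theta> \<longleftrightarrow> \<theta> = \<theta>hat n x"
      then have "is_arg_max (f n x) (\<lambda>\<theta>. \<theta> \<in> \<Theta>) (\<theta>hat n x)" by blast
      then show "\<forall>\<theta>\<in>\<Theta>. f n x \<theta> \<le> f n x (\<theta>hat n x)"
        by (auto simp: is_arg_max_def not_less)
    qed
  qed
  have f: "set_borel_measurable borel \<Theta> (f n x) \<and> (\<forall>\<theta>\<in>\<Theta>. 0 \<le> f n x \<theta>)"
    if "0 < n" "x \<in> space (?P n)" for n x
    using model that by (simp add: statistical_model_def true_law_def is_density_def)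
  obtain r where r: "0 < r" "C2_on (ball \<theta>star r) \<pi>" "\<And>\<theta>. \<theta> \<in> ball \<theta>star r \<Longrightarrow> 0 < \<pi> \<theta>"
    using A1 unfolding assm_A1_def by blast
  have \<pi>_int: "set_integrable lborel \<Theta> \<pi>" by (rule density_set_integrable[OF \<Theta> prior])
  have b_int: "set_integrable lborel \<Theta> (\<lambda>\<theta>. q \<theta> * \<pi> \<theta>)"
    using Lap by (simp add: assm_Lap_def)
  define B where "B = max 0 (max (LINT \<theta>:\<Theta>|lborel. \<bar>\<pi> \<theta>\<bar>) (LINT \<theta>:\<Theta>|lborel. \<bar>q \<theta> * \<pi> \<theta>\<bar>))"
  have B: "0 \<le> B" "(LINT \<theta>:\<Theta>|lborel. \<bar>\<pi> \<theta>\<bar>) \<le> B" "(LINT \<theta>:\<Theta>|lborel. \<bar>q \<theta> * \<pi> \<theta>\<bar>) \<le> B"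
    by (auto simp: B_def)
  define err1 where "err1 = (\<lambda>n x a. (LINT \<theta>:\<Theta>|lborel. q \<theta> * \<pi> \<theta> * f n x \<theta> powr a)
      / (f n x (\<theta>hat n x) powr a * det (H n x) powr (- 1 / 2)
         * (2 * pi / (a * real n)) powr (real CARD('p) / 2)) - q (\<theta>hat n x) * \<pi> (\<theta>hat n x))"
  define err2 where "err2 = (\<lambda>n x a. posterior_mean \<Theta> \<pi> (f n x) a q - q (\<theta>hat n x))"
  \<comment> \<open>The quantifier over \<open>a\<close> is inside the event, so \<open>a\<close> may depend on the sample \<open>x\<close>.\<close>
  have uniform: "\<exists>K\<ge>0. \<exists>N0. likely ?P \<epsilon> (\<lambda>n x. \<forall>a>0. N0 \<le> a * real n \<longrightarrow>
      \<bar>err1 n x a\<bar> \<le> K / (a * real n) \<and> \<bar>err2 n x a\<bar> \<le> K / (a * real n))" if \<epsilon>: "0 < \<epsilon>" for \<epsilon>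
  proof -
    obtain \<kappa> D \<delta> M C c M' \<pi>0 where k: "0 < \<kappa>" "0 < \<delta>" "0 < c" "0 < \<pi>0"
      "0 \<le> M" "0 \<le> C" "0 \<le> M'" "0 \<le> D" "C * \<delta> + M * \<delta>\<^sup>2 \<le> \<kappa> / 4"
      and lik: "likely ?P \<epsilon> (\<lambda>n x. peaked_likelihood \<Theta> (f n x) (\<theta>hat n x) (real n) (H n x) \<kappa> D \<delta> M C c \<and>
       linear_up_to_quadratic (\<lambda>\<theta>. q \<theta> * \<pi> \<theta>) (\<theta>hat n x) \<delta> M' \<and> linear_up_to_quadratic \<pi> (\<theta>hat n x) \<delta> M' \<and>
       \<pi>0 \<le> \<pi> (\<theta>hat n x))"
      by (rule regular_sample_likely[OF f alpha_pos mle cons r A2 A3 Lap \<epsilon>])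
        (assumption | rule that; assumption)+
    obtain K1 where K1: "0 \<le> K1" and exp1: "\<And>\<Theta> L (t :: real^'p) m H a b.
      peaked_likelihood \<Theta> L t m H \<kappa> D \<delta> M C c \<Longrightarrow>
      set_integrable lborel \<Theta> b \<Longrightarrow> (LINT \<theta>:\<Theta>|lborel. \<bar>b \<theta>\<bar>) \<le> B \<Longrightarrow>
      linear_up_to_quadratic b t \<delta> M' \<Longrightarrow> 0 < m \<Longrightarrow> 0 < a \<Longrightarrow> 1 \<le> a * m \<Longrightarrow>
      \<bar>(LINT \<theta>:\<Theta>|lborel. b \<theta> * L \<theta> powr a)
         / (L t powr a * det H powr (- 1 / 2) * (2 * pi / (a * m)) powr (real CARD('p) / 2)) - b t\<bar>
       \<le> K1 / (a * m)"
      using laplace_expansion[OF k(1-3,5-8) B(1) k(9), where 'p='p] by blast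
    obtain K2 N0 where K2: "0 \<le> K2" "1 \<le> N0" and exp2: "\<And>\<Theta> L (t :: real^'p) m H a \<pi> q.
      peaked_likelihood \<Theta> L t m H \<kappa> D \<delta> M C c \<Longrightarrow>
      set_integrable lborel \<Theta> \<pi> \<Longrightarrow> (LINT \<theta>:\<Theta>|lborel. \<bar>\<pi> \<theta>\<bar>) \<le> B \<Longrightarrow>
      linear_up_to_quadratic \<pi> t \<delta> M' \<Longrightarrow> \<pi>0 \<le> \<pi> t \<Longrightarrow>
      set_integrable lborel \<Theta> (\<lambda>\<theta>. q \<theta> * \<pi> \<theta>) \<Longrightarrow> (LINT \<theta>:\<Theta>|lborel. \<bar>q \<theta> * \<pi> \<theta>\<bar>) \<le> B \<Longrightarrow>
      linear_up_to_quadratic (\<lambda>\<theta>. q \<theta> * \<pi> \<theta>) t \<delta> M' \<Longrightarrow>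
      0 < m \<Longrightarrow> 0 < a \<Longrightarrow> N0 \<le> a * m \<Longrightarrow>
      \<bar>posterior_mean \<Theta> \<pi> L a q - q t\<bar> \<le> K2 / (a * m)"
      using posterior_mean_expansion[OF k(1-4) k(5-8) B(1) k(9), where 'p='p] by blast
    have "likely ?P \<epsilon> (\<lambda>n x. \<forall>a>0. N0 \<le> a * real n \<longrightarrow>
      \<bar>err1 n x a\<bar> \<le> max K1 K2 / (a * real n) \<and> \<bar>err2 n x a\<bar> \<le> max K1 K2 / (a * real n))"
      using lik
    proof (rule likely_mono)
      show "\<forall>\<^sub>F n in sequentially. \<forall>x\<in>space (?P n).
        peaked_likelihood \<Theta> (f n x) (\<theta>hat n x) (real n) (H n x) \<kappa> D \<delta> M C c \<and>
         linear_up_to_quadratic (\<lambda>\<theta>. q \<theta> * \<pi> \<theta>) (\<theta>hat n x) \<delta> M' \<and> linear_up_to_quadratic \<pi> (\<theta>hat n x) \<delta> M' \<and>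
         \<pi>0 \<le> \<pi> (\<theta>hat n x) \<longrightarrow>
        (\<forall>a>0. N0 \<le> a * real n \<longrightarrow>
          \<bar>err1 n x a\<bar> \<le> max K1 K2 / (a * real n) \<and> \<bar>err2 n x a\<bar> \<le> max K1 K2 / (a * real n))"
        using eventually_gt_at_top[of 0]
      proof eventually_elim
        case (elim n)
        show ?case
        proof (intro ballI impI allI, elim conjE)
          fix x and a :: real
          assume peak: "peaked_likelihood \<Theta> (f n x) (\<theta>hat n x) (real n) (H n x) \<kappa> D \<delta> M C c"
            and lin: "linear_up_to_quadratic (\<lambda>\<theta>. q \<theta> * \<pi> \<theta>) (\<theta>hat n x) \<delta> M'"
              "linear_up_to_quadratic \<pi> (\<theta>hat n x) \<delta> M'" and \<pi>0: "\<pi>0 \<le> \<pi> (\<theta>hat n x)"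
            and a: "0 < a" "N0 \<le> a * real n"
          have n: "0 < real n" using elim by simp
          have N1: "1 \<le> a * real n" using a K2 by linarith
          have "\<bar>err1 n x a\<bar> \<le> K1 / (a * real n)"
            unfolding err1_def by (rule exp1[OF peak b_int B(3) lin(1) n a(1) N1])
          moreover have "\<bar>err2 n x a\<bar> \<le> K2 / (a * real n)"
            unfolding err2_def by (rule exp2[OF peak \<pi>_int B(2) lin(2) \<pi>0 b_int B(3) lin(1) n a])
          moreover have "K1 / (a * real n) \<le> max K1 K2 / (a * real n)" "K2 / (a * real n) \<le> max K1 K2 / (a * real n)"
            using N1 by (intro divide_right_mono; simp)+
          ultimately show "\<bar>err1 n x a\<bar> \<le> max K1 K2 / (a * real n) \<and> \<bar>err2 n x a\<bar> \<le> max K1 K2 / (a * real n)"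
            by linarith
        qed
      qed
    qed
    then show ?thesis using K1 by (intro exI[of _ "max K1 K2"] conjI exI[of _ N0]) auto
  qed
  have rate: "0 < \<alpha> n * real n" if "0 < n" for n using alpha_pos[of n] that by simp
  have large: "\<forall>\<^sub>F n in sequentially. N0 \<le> \<alpha> n * real n" for N0
    using alpha_lim by (simp add: filterlim_at_top)
  have fixed: "\<exists>K\<ge>0. likely ?P \<epsilon> (\<lambda>n x. \<bar>err1 n x (\<alpha> n)\<bar> \<le> K / (\<alpha> n * real n) \<and> \<bar>err2 n x (\<alpha> n)\<bar> \<le> K / (\<alpha> n * real n))"
    if \<epsilon>: "0 < \<epsilon>" for \<epsilon>
  proof -
    obtain K N0 where K: "0 \<le> K" and lik: "likely ?P \<epsilon> (\<lambda>n x. \<forall>a>0. N0 \<le> a * real n \<longrightarrow>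
      \<bar>err1 n x a\<bar> \<le> K / (a * real n) \<and> \<bar>err2 n x a\<bar> \<le> K / (a * real n))"
      using uniform[OF \<epsilon>] by blast
    have "likely ?P \<epsilon> (\<lambda>n x. \<bar>err1 n x (\<alpha> n)\<bar> \<le> K / (\<alpha> n * real n) \<and> \<bar>err2 n x (\<alpha> n)\<bar> \<le> K / (\<alpha> n * real n))"
      by (rule likely_mono[OF lik], rule eventually_mono[OF large[of N0]]) (use alpha_pos in blast)
    then show ?thesis using K by blast
  qed
  have item1: "bigO_prob ?P (\<lambda>n x. err1 n x (\<alpha> n)) (\<lambda>n. 1 / (\<alpha> n * real n))"
  proof (rule bigO_prob_inverse_rateI[OF rate])
    fix \<epsilon> :: real assume "0 < \<epsilon>"
    from fixed[OF this] show "\<exists>K\<ge>0. likely ?P \<epsilon> (\<lambda>n x. \<bar>err1 n x (\<alpha> n)\<bar> \<le> K / (\<alpha> n * real n))"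
      by (blast intro: likely_mono always_eventually)
  qed
  have item2: "bigO_prob ?P (\<lambda>n x. err2 n x (\<alpha> n)) (\<lambda>n. 1 / (\<alpha> n * real n))"
  proof (rule bigO_prob_inverse_rateI[OF rate])
    fix \<epsilon> :: real assume "0 < \<epsilon>"
    from fixed[OF this] show "\<exists>K\<ge>0. likely ?P \<epsilon> (\<lambda>n x. \<bar>err2 n x (\<alpha> n)\<bar> \<le> K / (\<alpha> n * real n))"
      by (blast intro: likely_mono always_eventually)
  qed
  have item3: "bigO_prob ?P (\<lambda>n x. err2 n x (\<alpha>hat n x)) (\<lambda>n. 1 / (\<alpha> n * real n))"
    if ratio: "tendsto_in_prob ?P (\<lambda>n x. \<alpha>hat n x / \<alpha> n) 1" for \<alpha>hat :: "nat \<Rightarrow> (nat \<Rightarrow> real^'d) \<Rightarrow> real"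
  proof (rule bigO_prob_inverse_rateI[OF rate])
    fix \<epsilon> :: real assume \<epsilon>: "0 < \<epsilon>"
    then have \<epsilon>2: "0 < \<epsilon> / 2" by simp
    obtain K N0 where K: "0 \<le> K" and lik: "likely ?P (\<epsilon> / 2) (\<lambda>n x. \<forall>a>0. N0 \<le> a * real n \<longrightarrow>
      \<bar>err1 n x a\<bar> \<le> K / (a * real n) \<and> \<bar>err2 n x a\<bar> \<le> K / (a * real n))"
      using uniform[OF \<epsilon>2] by blast
    \<comment> \<open>On this event the data-dependent exponent is at least half of \<open>\<alpha> n\<close>, so the rate changes by a factor of at most \<open>2\<close>.\<close>
    have "likely ?P (\<epsilon> / 2) (\<lambda>n x. dist (\<alpha>hat n x / \<alpha> n) 1 \<le> 1 / 2)"
      by (rule likely_tendsto_in_prob[OF ratio _ \<epsilon>2]) simp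
    from likely_conj[OF lik this \<epsilon>2 \<epsilon>2]
    have "likely ?P \<epsilon> (\<lambda>n x. (\<forall>a>0. N0 \<le> a * real n \<longrightarrow>
      \<bar>err1 n x a\<bar> \<le> K / (a * real n) \<and> \<bar>err2 n x a\<bar> \<le> K / (a * real n)) \<and> dist (\<alpha>hat n x / \<alpha> n) 1 \<le> 1 / 2)"
      by simp
    then have "likely ?P \<epsilon> (\<lambda>n x. \<bar>err2 n x (\<alpha>hat n x)\<bar> \<le> 2 * K / (\<alpha> n * real n))"
    proof (rule likely_mono)
      show "\<forall>\<^sub>F n in sequentially. \<forall>x\<in>space (?P n). (\<forall>a>0. N0 \<le> a * real n \<longrightarrow>
        \<bar>err1 n x a\<bar> \<le> K / (a * real n) \<and> \<bar>err2 n x a\<bar> \<le> K / (a * real n)) \<and> dist (\<alpha>hat n x / \<alpha> n) 1 \<le> 1 / 2 \<longrightarrow>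
        \<bar>err2 n x (\<alpha>hat n x)\<bar> \<le> 2 * K / (\<alpha> n * real n)"
        using large[of "2 * N0"] eventually_gt_at_top[of 0]
      proof eventually_elim
        case (elim n)
        show ?case
        proof (intro ballI impI, elim conjE)
          fix x
          assume *: "\<forall>a>0. N0 \<le> a * real n \<longrightarrow>
            \<bar>err1 n x a\<bar> \<le> K / (a * real n) \<and> \<bar>err2 n x a\<bar> \<le> K / (a * real n)"
            and close: "dist (\<alpha>hat n x / \<alpha> n) 1 \<le> 1 / 2"
          have "1 / 2 \<le> \<alpha>hat n x / \<alpha> n" using close unfolding dist_real_def by linarith
          then have half: "\<alpha> n / 2 \<le> \<alpha>hat n x" using alpha_pos[of n] by (simp add: field_simps)
          then have ahat: "0 < \<alpha>hat n x" using alpha_pos[of n] by linarith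
          have N: "\<alpha> n * real n / 2 \<le> \<alpha>hat n x * real n"
            using mult_right_mono[OF half, of "real n"] by simp
          then have "\<bar>err2 n x (\<alpha>hat n x)\<bar> \<le> K / (\<alpha>hat n x * real n)"
            using * ahat elim(1) by simp
          also have "\<dots> \<le> K / (\<alpha> n * real n / 2)"
            using K N rate[OF elim(2)] by (intro divide_left_mono) auto
          finally show "\<bar>err2 n x (\<alpha>hat n x)\<bar> \<le> 2 * K / (\<alpha> n * real n)" by (simp add: mult.commute)
        qed
      qed
    qed
    then show "\<exists>K\<ge>0. likely ?P \<epsilon> (\<lambda>n x. \<bar>err2 n x (\<alpha>hat n x)\<bar> \<le> K / (\<alpha> n * real n))"
      using K by (intro exI[of _ "2 * K"]) simp
  qed
  show ?thesis
    using item1 item2 item3 unfolding err1_def err2_def by blast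
qed

end
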